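(* Let $d \geq 3$ be an integer and let $T_d$ be the $d$-regular infinite tree. For any real number $\lambda$ with $|\lambda| \leq d$ there exists a non-trivial invariant Gaussian process $(X_v)_{v \in V(T_d)}$ on $T_d$ that satisfies the eigenvector equation with eigenvalue $\lambda$, i.e., with probability $1$, for every vertex $v$ it holds that $$\sum_{u \in N(v)} X_u = \lambda X_v,$$ where $N(v)$ denotes the set of neighbors of $v$ in $T_d$. Moreover, the joint distribution of such a process is unique under the additional condition that the variance of $X_v$ is $1$ (for every $v$).
   Context: $V(T_d)$ is the vertex set of $T_d$ and $\mathrm{Aut}(T_d)$ is its group of graph automorphisms. A collection of real random variables $X_v$, $v \in V(T_d)$, is a Gaussian process on $T_d$ if they are jointly Gaussian (every finite linear combination of them is Gaussian) and each $X_v$ is centered. It is invariant if for every $\Phi \in \mathrm{Aut}(T_d)$ the joint distribution of $(X_{\Phi(v)})_{v}$ is the same as that of $(X_v)_{v}$. Non-trivial means that the $X_v$ are not almost surely $0$. Degenerate (zero variance) Gaussians are allowed in the definition of jointly Gaussian. *)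

theory Defs
  imports "HOL-Probability.Probability"
begin

type_synonym 'v edges = "('v \<times> 'v) set"

definition simple_graph :: "'v set \<Rightarrow> 'v edges \<Rightarrow> bool" where
  "simple_graph V E \<longleftrightarrow> E \<subseteq> V \<times> V \<and> sym E \<and> irrefl E"

definition nbrs :: "'v edges \<Rightarrow> 'v \<Rightarrow> 'v set" where
  "nbrs E v = {u. (v, u) \<in> E}"

definition connected_graph :: "'v set \<Rightarrow> 'v edges \<Rightarrow> bool" where
  "connected_graph V E \<longleftrightarrow> (\<forall>u\<in>V. \<forall>v\<in>V. (u, v) \<in> E\<^sup>*)"

(* Undirected cycles: since E is symmetric, "acyclic E" would be false for every nonempty E. *)
definition graph_cycle :: "'v edges \<Rightarrow> 'v list \<Rightarrow> bool" where
  "graph_cycle E p \<longleftrightarrow> 3 \<le> length p \<and> distinct p \<and>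
     (\<forall>i<length p. (p ! i, p ! (Suc i mod length p)) \<in> E)"

definition tree_graph :: "'v set \<Rightarrow> 'v edges \<Rightarrow> bool" where
  "tree_graph V E \<longleftrightarrow> simple_graph V E \<and> V \<noteq> {} \<and> connected_graph V E \<and> \<not> (\<exists>p. graph_cycle E p)"

(* For d >= 2 such a graph exists and is unique up to isomorphism, so this is "the" d-regular tree. *)
definition regular_infinite_tree :: "nat \<Rightarrow> 'v set \<Rightarrow> 'v edges \<Rightarrow> bool" where
  "regular_infinite_tree d V E \<longleftrightarrow> tree_graph V E \<and> infinite V \<and>
     (\<forall>v\<in>V. finite (nbrs E v) \<and> card (nbrs E v) = d)"

(* Values of an automorphism outside V are unconstrained and never used. *)
definition graph_aut :: "'v set \<Rightarrow> 'v edges \<Rightarrow> ('v \<Rightarrow> 'v) set" where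
  "graph_aut V E = {\<Phi>. bij_betw \<Phi> V V \<and> (\<forall>u\<in>V. \<forall>v\<in>V. (\<Phi> u, \<Phi> v) \<in> E \<longleftrightarrow> (u, v) \<in> E)}"

(* The second disjunct is the degenerate (zero variance) case. *)
definition gaussian_rv :: "'a measure \<Rightarrow> ('a \<Rightarrow> real) \<Rightarrow> bool" where
  "gaussian_rv M Y \<longleftrightarrow> Y \<in> borel_measurable M \<and>
     ((\<exists>\<mu> \<sigma>. 0 < \<sigma> \<and> distributed M lborel Y (normal_density \<mu> \<sigma>)) \<or>
      (\<exists>\<mu>. AE \<omega> in M. Y \<omega> = \<mu>))"

definition jointly_gaussian :: "'a measure \<Rightarrow> 'v set \<Rightarrow> ('v \<Rightarrow> 'a \<Rightarrow> real) \<Rightarrow> bool" where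
  "jointly_gaussian M V X \<longleftrightarrow>
     (\<forall>F c. finite F \<and> F \<subseteq> V \<longrightarrow> gaussian_rv M (\<lambda>\<omega>. \<Sum>v\<in>F. c v * X v \<omega>))"

definition gaussian_process :: "'a measure \<Rightarrow> 'v set \<Rightarrow> ('v \<Rightarrow> 'a \<Rightarrow> real) \<Rightarrow> bool" where
  "gaussian_process M V X \<longleftrightarrow> prob_space M \<and> jointly_gaussian M V X \<and>
     (\<forall>v\<in>V. prob_space.expectation M (X v) = 0)"

definition joint_law :: "'a measure \<Rightarrow> 'v set \<Rightarrow> ('v \<Rightarrow> 'a \<Rightarrow> real) \<Rightarrow> ('v \<Rightarrow> real) measure" where
  "joint_law M V X = distr M (\<Pi>\<^sub>M v\<in>V. borel) (\<lambda>\<omega>. \<lambda>v\<in>V. X v \<omega>)"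

definition invariant_process ::
    "'a measure \<Rightarrow> 'v set \<Rightarrow> 'v edges \<Rightarrow> ('v \<Rightarrow> 'a \<Rightarrow> real) \<Rightarrow> bool" where
  "invariant_process M V E X \<longleftrightarrow>
     (\<forall>\<Phi>\<in>graph_aut V E. joint_law M V (\<lambda>v. X (\<Phi> v)) = joint_law M V X)"

definition nontrivial_process :: "'a measure \<Rightarrow> 'v set \<Rightarrow> ('v \<Rightarrow> 'a \<Rightarrow> real) \<Rightarrow> bool" where
  "nontrivial_process M V X \<longleftrightarrow> (\<forall>v\<in>V. \<not> (AE \<omega> in M. X v \<omega> = 0))"

definition eigenvector_equation ::
    "'a measure \<Rightarrow> 'v set \<Rightarrow> 'v edges \<Rightarrow> real \<Rightarrow> ('v \<Rightarrow> 'a \<Rightarrow> real) \<Rightarrow> bool" where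
  "eigenvector_equation M V E l X \<longleftrightarrow>
     (AE \<omega> in M. \<forall>v\<in>V. (\<Sum>u\<in>nbrs E v. X u \<omega>) = l * X v \<omega>)"

definition gaussian_eigenprocess ::
    "'a measure \<Rightarrow> 'v set \<Rightarrow> 'v edges \<Rightarrow> real \<Rightarrow> ('v \<Rightarrow> 'a \<Rightarrow> real) \<Rightarrow> bool" where
  "gaussian_eigenprocess M V E l X \<longleftrightarrow> gaussian_process M V X \<and> invariant_process M V E X \<and>
     nontrivial_process M V X \<and> eigenvector_equation M V E l X"

end

theory Submission
  imports Defs "HOL-Library.Transitive_Closure_Table"
begin

text \<open>
  Root the tree and build the process outwards from independent standard normal variables: given its
  parent \<open>v\<close> and grandparent \<open>p\<close>, a vertex is \<open>(l * X\<^sub>v - X\<^sub>p) / (d - 1)\<close> plus a multiple of a noise that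
  sums to \<open>0\<close> over siblings, so the eigenvector equation holds identically. The multiple is chosen to
  make all variances \<open>1\<close>, which is possible exactly when \<open>\<bar>l\<bar> \<le> d\<close>. The correlation of two vertices then
  depends only on their distance, so automorphisms preserve the covariance.

  Conversely, for an invariant process the covariance with a fixed vertex \<open>r\<close> is constant on siblings of
  the tree rooted at \<open>r\<close>, since automorphisms fixing \<open>r\<close> permute siblings; the eigenvector equation then
  becomes a recursion that determines it. In both directions one uses that the covariance of a
  centered Gaussian process determines its law, by the Cramer-Wold device.
\<close>

section \<open>The rooted regular tree and its positive definite kernel\<close>

text \<open>With the noise centred over siblings, the only free parameter for the children of a
  vertex is its scale, and the variance fixes it. The covariance of two siblings is then no longer
  at choice, yet it has to be the value of \<open>tree_corr\<close> at distance 2. It is, because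
  the average over exchangeable children of unit variance equals the predictor, whose variance
  determines their common covariance. At \<bar>l\<bar> = d the scale is 0 and the root variable
  determines everything. The choice of a root breaks the symmetry, so invariance is invisible in the
  construction and has to be recovered from covariances alone. For the comparison of laws, the
  passage from one dimension to finitely many restricts the measure to an event for one coordinate
  at a time. Restrictions are not normalised, which is why that part deals with finite measures
  instead of probability measures.\<close>

function tree_dist :: "'a list \<Rightarrow> 'a list \<Rightarrow> nat" where
  "tree_dist x y = (if x = y then 0 else if length y \<le> length x then Suc (tree_dist (tl x) y)
     else Suc (tree_dist x (tl y)))"
  by pat_completeness auto
termination
proof (relation "Wellfounded.measure (\<lambda>(x, y). length x + length y)")
  fix x y :: "'a list" assume "x \<noteq> y" "length y \<le> length x"
  then show "((tl x, y), x, y) \<in> Wellfounded.measure (\<lambda>(x, y). length x + length y)"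
    by (cases x) auto
next
  fix x y :: "'a list" assume "x \<noteq> y" "\<not> length y \<le> length x"
  then show "((x, tl y), x, y) \<in> Wellfounded.measure (\<lambda>(x, y). length x + length y)"
    by (cases y) auto
qed simp

declare tree_dist.simps [simp del]

lemma tree_dist_same [simp]: "tree_dist x x = 0"
  by (simp add: tree_dist.simps)

lemma tree_dist_Cons_left:
  "x \<noteq> i # v \<Longrightarrow> length x \<le> Suc (length v) \<Longrightarrow> tree_dist (i # v) x = Suc (tree_dist v x)"
  by (subst tree_dist.simps) auto

text \<open>On a tie the recursion shortens the left list, so symmetry is not built in. For distinct
  lists of equal length, either order of the arguments removes one head from each list within two
  steps.\<close>

lemma tree_dist_commute: "tree_dist x y = tree_dist y x"
proof (induction "length x + length y" arbitrary: x y rule: less_induct)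
  case less
  consider "x = y" | "x \<noteq> y" "length y < length x" | "x \<noteq> y" "length x < length y"
    | "x \<noteq> y" "length x = length y" by linarith
  then show ?case
  proof cases
    case 2
    then have "tree_dist (tl x) y = tree_dist y (tl x)"
      by (intro less) (cases x; auto)
    with 2 show ?thesis
      by (simp add: tree_dist.simps [of x y] tree_dist.simps [of y x])
  next
    case 3
    then have "tree_dist (tl y) x = tree_dist x (tl y)"
      by (intro less) (cases y; auto)
    with 3 show ?thesis
      by (simp add: tree_dist.simps [of x y] tree_dist.simps [of y x])
  next
    case 4
    then obtain i v j w where xy: "x = i # v" "y = j # w" "length v = length w"
      by (cases x; cases y) auto
    have "tree_dist v w = tree_dist w v"
      by (intro less) (simp add: xy)
    moreover have "v \<noteq> j # w" "w \<noteq> i # v" using xy by auto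
    ultimately show ?thesis
      using 4 xy by (simp add: tree_dist.simps [of "i # v" "j # w"] tree_dist.simps [of "j # w" "i # v"]
          tree_dist.simps [of v "j # w"] tree_dist.simps [of w "i # v"])
  qed simp
qed

text \<open>Makes the recursive distance change by at most one along an edge, which is how
  \<open>tree_dist_le\<close> bounds it by walk lengths.\<close>

lemma tree_dist_Cons_right_cases:
  "tree_dist x (k # y) = Suc (tree_dist x y) \<or> tree_dist x y = Suc (tree_dist x (k # y))"
proof (induction x)
  case Nil
  show ?case by (simp add: tree_dist.simps [of "[]" "k # y"])
next
  case (Cons i x)
  show ?case
  proof (cases "length (k # y) \<le> length (i # x)")
    case True
    show ?thesis
    proof (cases "i # x = k # y")
      case True
      then show ?thesis by (auto simp: tree_dist.simps [of "k # y" y])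
    next
      case False
      have "i # x \<noteq> y" using True by auto
      with False True Cons show ?thesis
        by (simp add: tree_dist.simps [of "i # x"])
    qed
  next
    case False
    then show ?thesis by (auto simp: tree_dist.simps [of "i # x" "k # y"])
  qed
qed

text \<open>The vertices of the rooted \<open>d\<close>-regular tree are addressed by lists: the root is \<open>[]\<close>
  and the children of \<open>v\<close> are the lists \<open>i # v\<close>.\<close>

definition num_children :: "nat \<Rightarrow> nat list \<Rightarrow> nat" where
  "num_children d v = (if v = [] then d else d - 1)"

fun address :: "nat \<Rightarrow> nat list \<Rightarrow> bool" where
  "address d [] \<longleftrightarrow> True"
| "address d (i # v) \<longleftrightarrow> i < num_children d v \<and> address d v"

lemma finite_addresses: "finite {x. address d x \<and> length x \<le> N}"
proof (rule finite_subset)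
  have "x \<in> lists {..<d}" if "address d x" for x
    using that by (induction x) (auto simp: num_children_def split: if_splits)
  then show "{x. address d x \<and> length x \<le> N} \<subseteq> {xs. set xs \<subseteq> {..<d} \<and> length xs \<le> N}"
    by auto
  show "finite {xs. set xs \<subseteq> {..<d} \<and> length xs \<le> N}"
    by (rule finite_lists_length_le) simp
qed

text \<open>The correlation at distance \<open>n\<close> forced by the eigenvector equation.\<close>

fun tree_corr :: "nat \<Rightarrow> real \<Rightarrow> nat \<Rightarrow> real" where
  "tree_corr d l 0 = 1"
| "tree_corr d l (Suc 0) = l / d"
| "tree_corr d l (Suc (Suc n)) = (l * tree_corr d l (Suc n) - tree_corr d l n) / (real d - 1)"

text \<open>Coefficients of the normal variable at \<open>i # v\<close> minus the average of those
  at all children of \<open>v\<close>. Without the test \<open>z \<noteq> []\<close> the root would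
  count as its own child, since \<open>tl [] = []\<close>.\<close>

definition noise :: "nat \<Rightarrow> nat \<Rightarrow> nat list \<Rightarrow> nat list \<Rightarrow> real" where
  "noise d i v z = of_bool (z = i # v) - of_bool (z \<noteq> [] \<and> tl z = v) / num_children d v"

text \<open>Variance of \<open>predictor\<close> when all variances are 1 and neighbours have
  covariance \<open>l / d\<close>, which produces the mixed term
  \<open>2 * l\<^sup>2 / d\<close>.\<close>

fun predictor_var :: "nat \<Rightarrow> real \<Rightarrow> nat list \<Rightarrow> real" where
  "predictor_var d l [] = l\<^sup>2 / (real d)\<^sup>2"
| "predictor_var d l (j # v) = (l\<^sup>2 + 1 - 2 * l\<^sup>2 / d) / (real d - 1)\<^sup>2"

text \<open>The scale of the noise makes the variance of a child equal to \<open>1\<close>: the centred noise of one child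
  among \<open>m\<close> siblings has variance \<open>1 - 1 / m\<close>.\<close>

definition noise_scale :: "nat \<Rightarrow> real \<Rightarrow> nat list \<Rightarrow> real" where
  "noise_scale d l v = sqrt ((1 - predictor_var d l v) / (1 - 1 / num_children d v))"

text \<open>The eigenvector equation prescribes the sum over the children: \<open>l\<close> times
  the value at the vertex, minus the value at its parent if there is one. This is the equal share of
  each child. In the second clause \<open>v\<close> is the parent of the vertex
  \<open>j # v\<close>.\<close>

fun predictor :: "nat \<Rightarrow> real \<Rightarrow> (nat list \<Rightarrow> real) \<Rightarrow> nat list \<Rightarrow> real" where
  "predictor d l f [] = l / d * f []"
| "predictor d l f (j # v) = (l * f (j # v) - f v) / (real d - 1)"

text \<open>\<open>coef d l x z\<close> is the coefficient of the independent normal variable at \<open>z\<close>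
  in the process at \<open>x\<close>.\<close>

fun coef :: "nat \<Rightarrow> real \<Rightarrow> nat list \<Rightarrow> nat list \<Rightarrow> real" where
  "coef d l [] z = of_bool (z = [])"
| "coef d l [i] z = l / d * coef d l [] z + noise_scale d l [] * noise d i [] z"
| "coef d l (i # j # v) z = (l * coef d l (j # v) z - coef d l v z) / (real d - 1)
     + noise_scale d l (j # v) * noise d i (j # v) z"

lemma coef_Cons:
  "coef d l (i # v) z = predictor d l (\<lambda>x. coef d l x z) v + noise_scale d l v * noise d i v z"
  by (cases v) auto

text \<open>Noise is centred over siblings, so the normal variable at \<open>k # v\<close> can enter
  at every vertex strictly below \<open>v\<close>, not only in the branch of \<open>k # v\<close>,
  but nowhere else.\<close>

lemma coef_Cons_eq_0:
  "(\<And>ys j. y \<noteq> ys @ j # v) \<Longrightarrow> coef d l y (k # v) = 0"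
proof (induction d l y "k # v" rule: coef.induct)
  case (2 d l i)
  from 2(2)[of "[]" i] show ?case by (auto simp: noise_def)
next
  case (3 d l i j w)
  have "coef d l (j # w) (k # v) = 0"
    by (rule 3) (use 3(3)[of "i # _"] in auto)
  moreover have "coef d l w (k # v) = 0"
    by (rule 3) (use 3(3)[of "i # j # _"] in auto)
  ultimately show ?case
    using 3(3)[of "[]" i] by (auto simp: noise_def)
qed auto

lemma coef_eq_0_if_longer:
  assumes "length x < length z"
  shows "coef d l x z = 0"
proof (cases z)
  case (Cons k v)
  then show ?thesis using assms by (auto intro!: coef_Cons_eq_0)
qed (use assms in simp)

text \<open>Both clauses reduce to \<open>l\<^sup>2 \<le> (real d)\<^sup>2\<close>. Away from the
  root this is because
  \<open>(real d - 1)\<^sup>2 - 1 = (real d)\<^sup>2 * (1 - 2 / d)\<close>.\<close>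

lemma predictor_var_le_1:
  assumes "d \<ge> 3" "\<bar>l\<bar> \<le> real d"
  shows "predictor_var d l v \<le> 1"
proof -
  have l2: "l\<^sup>2 \<le> (real d)\<^sup>2"
    using assms(2) by (simp add: abs_le_square_iff [symmetric])
  show ?thesis
  proof (cases v)
    case Nil
    then show ?thesis using l2 assms by (simp add: divide_simps)
  next
    case (Cons j w)
    have "l\<^sup>2 * (1 - 2 / d) \<le> (real d)\<^sup>2 * (1 - 2 / d)"
      using l2 assms by (intro mult_right_mono) auto
    also have "\<dots> = (real d - 1)\<^sup>2 - 1"
      using assms by (simp add: field_simps power2_eq_square)
    finally have "l\<^sup>2 + 1 - 2 * l\<^sup>2 / d \<le> (real d - 1)\<^sup>2"
      by (simp add: algebra_simps)
    then show ?thesis using Cons assms by simp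
  qed
qed

text \<open>The noises of siblings cancel and the common predictor is counted
  \<open>num_children d v\<close> times. Since this holds for each coefficient, the eigenvector
  equation will hold at every sample point.\<close>

lemma sum_coef_children:
  assumes d: "d \<ge> 3" and z: "address d z"
  shows "(\<Sum>i<num_children d v. coef d l (i # v) z) + (if v = [] then 0 else coef d l (tl v) z)
    = l * coef d l v z"
proof -
  let ?m = "num_children d v"
  have m: "?m > 0" "real ?m = (if v = [] then real d else real d - 1)"
    using d by (auto simp: num_children_def)
  have "(\<Sum>i<?m. noise d i v z) = (\<Sum>i<?m. of_bool (z = i # v)) - of_bool (z \<noteq> [] \<and> tl z = v)"
    using m(1) by (simp add: noise_def sum_subtractf)
  \<comment> \<open>As \<open>z\<close> is an address, the head of a child \<open>z\<close> of
    \<open>v\<close> is below \<open>?m\<close>, so exactly one summand is 1.\<close>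
  also have "(\<Sum>i<?m. of_bool (z = i # v)) = (of_bool (z \<noteq> [] \<and> tl z = v) :: real)"
    using z by (cases z) (auto simp: of_bool_def if_distrib cong: if_cong)
  finally have "(\<Sum>i<?m. noise d i v z) = 0" by simp
  then have "(\<Sum>i<?m. coef d l (i # v) z) = ?m * predictor d l (\<lambda>x. coef d l x z) v"
    by (simp add: coef_Cons sum.distrib sum_distrib_left [symmetric])
  also have "\<dots> = l * coef d l v z - (if v = [] then 0 else coef d l (tl v) z)"
    using m d by (cases v) auto
  finally show ?thesis by simp
qed

lemma sum_noise_orthogonal:
  assumes "\<And>k. f (k # v) = 0"
  shows "(\<Sum>z\<in>S. noise d i v z * f z) = 0"
proof (rule sum.neutral, rule ballI)
  fix z
  show "noise d i v z * f z = 0"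
    using assms[of i] assms[of "hd z"] by (cases z) (auto simp: noise_def)
qed

text \<open>The covariance matrix of \<open>num_children d v\<close> independent standard normals
  after subtracting their average. The strict bound on \<open>length v\<close> puts all children of
  \<open>v\<close> into the range of summation.\<close>

lemma sum_noise_noise:
  assumes d: "d \<ge> 3" and v: "address d v" "length v < N"
    and ij: "i < num_children d v" "j < num_children d v"
  shows "(\<Sum>z | address d z \<and> length z \<le> N. noise d i v z * noise d j v z)
    = of_bool (i = j) - 1 / num_children d v"
proof -
  let ?m = "num_children d v" and ?S = "{z. address d z \<and> length z \<le> N}"
  have m: "real ?m > 0" using ij by simp
  have ind: "(\<Sum>k<?m. of_bool (k = i)) = (1 :: real)" if "i < ?m" for i
    using that by (simp add: of_bool_def)
  have "(\<Sum>z\<in>?S. noise d i v z * noise d j v z)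
    = (\<Sum>z\<in>(\<lambda>k. k # v) ` {..<?m}. noise d i v z * noise d j v z)"
  proof (rule sum.mono_neutral_right)
    show "\<forall>z\<in>?S - (\<lambda>k. k # v) ` {..<?m}. noise d i v z * noise d j v z = 0"
    proof
      fix z assume "z \<in> ?S - (\<lambda>k. k # v) ` {..<?m}"
      then show "noise d i v z * noise d j v z = 0"
        using ij by (cases z) (auto simp: noise_def)
    qed
  qed (use v finite_addresses in auto)
  also have "\<dots> = (\<Sum>k<?m. (of_bool (k = i) - 1 / ?m) * (of_bool (k = j) - 1 / ?m))"
    by (subst sum.reindex) (auto simp: inj_on_def noise_def)
  also have "\<dots> = (\<Sum>k<?m. of_bool (k = i) * of_bool (i = j) - of_bool (k = i) / ?m
      - of_bool (k = j) / ?m + 1 / ?m\<^sup>2)"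
    by (intro sum.cong refl) (auto simp: algebra_simps power2_eq_square)
  also have "\<dots> = of_bool (i = j) - 1 / ?m - 1 / ?m + ?m * (1 / ?m\<^sup>2)"
    by (simp only: sum.distrib sum_subtractf ind [OF ij(1)] ind [OF ij(2)]
        flip: sum_divide_distrib sum_distrib_right) simp
  also have "\<dots> = of_bool (i = j) - 1 / ?m"
    using m by (simp add: power2_eq_square)
  finally show ?thesis .
qed

text \<open>By its length, \<open>y\<close> could lie below \<open>v\<close> only as a child, which
  is excluded; so the path from \<open>v\<close> to \<open>y\<close> leaves through the parent
  \<open>u\<close>. If \<open>y\<close> is one level deeper than \<open>v\<close>, the recursion
  shortens \<open>y\<close> first.\<close>

lemma tree_dist_parent:
  assumes "y \<noteq> i # v" "y \<noteq> v" "v = j # u" "length y \<le> Suc (length v)" "\<And>k. y \<noteq> k # v"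
  shows "tree_dist v y = Suc (tree_dist u y)"
proof (cases "length y \<le> length v")
  case True
  then show ?thesis using assms by (simp add: tree_dist_Cons_left)
next
  case False
  then obtain k w where y: "y = k # w" "length w = length v"
    using assms by (cases y) auto
  have "w \<noteq> v" using assms(5)[of k] y by auto
  then have "tree_dist v w = Suc (tree_dist u w)"
    using assms y by (simp add: tree_dist_Cons_left)
  moreover have "tree_dist v y = Suc (tree_dist v w)"
    using y by (subst tree_dist.simps) auto
  moreover have "tree_dist u y = Suc (tree_dist u w)"
    using y assms(3) by (subst tree_dist.simps) auto
  ultimately show ?thesis by simp
qed

text \<open>Positive definiteness of the kernel \<open>tree_corr\<close>: it is the Gram matrix of the coefficient vectors.\<close>

lemma sum_coef_coef:
  assumes d: "d \<ge> 3" "\<bar>l\<bar> \<le> real d"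
    and "address d x" "address d y" "length x \<le> N" "length y \<le> N"
  shows "(\<Sum>z | address d z \<and> length z \<le> N. coef d l x z * coef d l y z)
    = tree_corr d l (tree_dist x y)"
  using assms(3-)
proof (induction "length x + length y" arbitrary: x y rule: less_induct)
  case less
  define S where "S = {z. address d z \<and> length z \<le> N}"
  define ip where "ip f g = (\<Sum>z\<in>S. f z * g z)" for f g :: "nat list \<Rightarrow> real"
  have fin: "finite S" unfolding S_def by (rule finite_addresses)
  have IH: "ip (coef d l x') (coef d l y') = tree_corr d l (tree_dist x' y')"
    if "length x' + length y' < length x + length y" "x' \<in> S" "y' \<in> S" for x' y'
    using less that unfolding ip_def S_def by auto
  have ip_commute: "ip f g = ip g f" for f g
    by (simp add: ip_def mult.commute)
  have ip_lin: "ip (\<lambda>z. a * f z + b * g z) h = a * ip f h + b * ip g h" for a b f g h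
    by (simp add: ip_def algebra_simps sum.distrib sum_distrib_left)
  \<comment> \<open>Only the longer list is split into predictor and noise. The induction hypothesis
    is an assumption here so that it can be used with \<open>x\<close> and \<open>y\<close>
    exchanged.\<close>
  have wlog: "ip (coef d l x) (coef d l y) = tree_corr d l (tree_dist x y)"
    if le: "length y \<le> length x" and xyS: "x \<in> S" "y \<in> S"
      and IH: "\<And>x' y'. length x' + length y' < length x + length y \<Longrightarrow> x' \<in> S \<Longrightarrow> y' \<in> S \<Longrightarrow>
        ip (coef d l x') (coef d l y') = tree_corr d l (tree_dist x' y')" for x y
  proof (cases x)
    case Nil
    have "ip (coef d l []) (coef d l []) = (\<Sum>z\<in>S. if z = [] then 1 else 0)"
      unfolding ip_def by (intro sum.cong) auto
    also have "\<dots> = 1" using fin by (simp add: S_def)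
    finally show ?thesis using Nil le by simp
  next
    case (Cons i v)
    let ?m = "num_children d v"
    define P where "P z = predictor d l (\<lambda>x. coef d l x z) v" for z
    have v: "address d v" "length v < N" "i < ?m" "v \<in> S"
      using Cons xyS by (auto simp: S_def)
    have m: "real ?m = (if v = [] then real d else real d - 1)" "real ?m > 1"
      using d by (auto simp: num_children_def)
    have coef_split: "coef d l (k # v) = (\<lambda>z. 1 * P z + noise_scale d l v * noise d k v z)" for k
      by (simp add: coef_Cons P_def fun_eq_iff)
    have noise_orth: "ip (noise d k v) f = 0" if "\<And>j. f (j # v) = 0" for k f
      using sum_noise_orthogonal [of f v, OF that] by (simp add: ip_def)
    have coef_0: "coef d l w (j # v) = 0" if "length w \<le> length v" for w j
      by (rule coef_Cons_eq_0) (use that in auto)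
    have P_0: "P (j # v) = 0" for j
      unfolding P_def by (cases v) (use coef_0 in auto)
    show ?thesis
    \<comment> \<open>The noise of \<open>x\<close> is correlated with \<open>y\<close> only if
      \<open>y\<close> is a child of \<open>v\<close> as well: any other \<open>y\<close> of this
      length lies outside the branches below \<open>v\<close>.\<close>
    proof (cases "\<exists>k. y = k # v")
      case True
      then obtain k where y: "y = k # v" by blast
      have k: "k < ?m" using y xyS by (simp add: S_def)
      have s2: "(noise_scale d l v)\<^sup>2 = (1 - predictor_var d l v) / (1 - 1 / ?m)"
        unfolding noise_scale_def using m predictor_var_le_1 [OF d, of v]
        by (intro real_sqrt_pow2 divide_nonneg_nonneg) auto
      have noise_noise: "ip (noise d k v) (noise d i v) = of_bool (k = i) - 1 / ?m"
        using sum_noise_noise [OF d(1) v(1,2) k v(3)] by (simp add: ip_def S_def)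
      have PP: "ip P P = predictor_var d l v"
      proof (cases v)
        case Nil
        have "P = (\<lambda>z. l / d * coef d l [] z)"
          by (simp add: P_def Nil fun_eq_iff)
        then have "ip P P = (l / d)\<^sup>2 * ip (coef d l []) (coef d l [])"
          unfolding ip_def sum_distrib_left
          by (intro sum.cong refl) (simp only: power2_eq_square ac_simps)
        also have "ip (coef d l []) (coef d l []) = 1"
          using IH [of "[]" "[]"] Cons by (simp add: S_def)
        finally show ?thesis using Nil by (simp add: power_divide)
      next
        case v': (Cons j u)
        have uS: "u \<in> S" using v v' by (simp add: S_def)
        define a b where "a = l / (real d - 1)" and "b = - 1 / (real d - 1)"
        have P': "P = (\<lambda>z. a * coef d l v z + b * coef d l u z)"
          by (simp add: P_def [abs_def] v' a_def b_def fun_eq_iff diff_divide_distrib)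
        have e: "ip (coef d l v) (coef d l v) = 1" "ip (coef d l u) (coef d l u) = 1"
          "ip (coef d l v) (coef d l u) = l / d"
          using IH [of v v] IH [of u u] IH [of v u] v uS Cons y v'
          by (auto simp: tree_dist_Cons_left)
        have "ip P P = a * ip (coef d l v) P + b * ip (coef d l u) P"
          by (subst P') (rule ip_lin)
        also have "ip (coef d l v) P = a + b * (l / d)"
          by (subst ip_commute, subst P', subst ip_lin) (simp add: e ip_commute [of "coef d l u"])
        also have "ip (coef d l u) P = a * (l / d) + b"
          by (subst ip_commute, subst P', subst ip_lin) (simp add: e)
        also have "a * (a + b * (l / d)) + b * (a * (l / d) + b)
            = (l\<^sup>2 + 1 - 2 * l\<^sup>2 / d) / (real d - 1)\<^sup>2"
          using d by (simp add: a_def b_def divide_simps) (simp add: algebra_simps power2_eq_square)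
        finally show ?thesis using v' by simp
      qed
      have "ip (coef d l x) (coef d l y) = ip P (coef d l y)
          + noise_scale d l v * ip (noise d i v) (coef d l y)"
        unfolding Cons by (subst coef_split, subst ip_lin) simp
      also have "ip P (coef d l y) = predictor_var d l v"
        by (subst ip_commute, unfold y, subst coef_split, subst ip_lin)
          (simp add: PP noise_orth P_0)
      also have "ip (noise d i v) (coef d l y) = noise_scale d l v * (of_bool (k = i) - 1 / ?m)"
        by (subst ip_commute, unfold y, subst coef_split, subst ip_lin)
          (simp add: ip_commute [of P] noise_orth P_0 noise_noise)
      finally have eq: "ip (coef d l x) (coef d l y) = predictor_var d l v
          + (1 - predictor_var d l v) / (1 - 1 / ?m) * (of_bool (k = i) - 1 / ?m)"
        unfolding s2 [symmetric] by (simp add: power2_eq_square)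
      show ?thesis
      proof (cases "k = i")
        case True
        then show ?thesis using eq m Cons y by simp
      next
        case False
        have "tree_dist x y = 2"
          using False Cons y by (simp add: tree_dist_Cons_left tree_dist.simps [of v "k # v"])
        then have R: "tree_corr d l (tree_dist x y) = (l * (l / d) - 1) / (real d - 1)"
          by (simp add: numeral_2_eq_2)
        \<comment> \<open>The right-hand side is the covariance c obtained by solving (1 + (m - 1)
          c) / m = \<open>predictor_var d l v\<close>, the variance of the average of m exchangeable
          siblings of unit variance.\<close>
        have "predictor_var d l v + (1 - predictor_var d l v) / (1 - 1 / ?m) * (- 1 / ?m)
            = (?m * predictor_var d l v - 1) / (?m - 1)"
          using m(2) by (simp add: divide_simps) (simp add: algebra_simps)
        also have "\<dots> = (l * (l / d) - 1) / (real d - 1)"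
        proof (cases v)
          case Nil
          then show ?thesis using m d by (simp add: divide_simps power2_eq_square)
        next
          case (Cons j u)
          then have "?m * predictor_var d l v - 1
              = ((l\<^sup>2 + 1 - 2 * l\<^sup>2 / d) - (real d - 1)) / (real d - 1)"
            using m d by (simp add: divide_simps power2_eq_square)
          \<comment> \<open>The factor \<open>real d - 2\<close> is \<open>?m - 1\<close> away from
            the root and cancels the denominator.\<close>
          also have "(l\<^sup>2 + 1 - 2 * l\<^sup>2 / d) - (real d - 1) = (real d - 2) * (l * (l / d) - 1)"
            using d by (simp add: field_simps power2_eq_square)
          finally show ?thesis
            using m d Cons by simp
        qed
        finally show ?thesis using eq R False by simp
      qed
    next
      case False
      have xy: "y \<noteq> i # v" using False by auto
      have len: "length y \<le> Suc (length v)" using le Cons by simp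
      have y_0: "coef d l y (j # v) = 0" for j
      proof (rule coef_Cons_eq_0)
        fix ys k show "y \<noteq> ys @ k # v"
          using False len by (cases ys) auto
      qed
      have *: "ip (coef d l x) (coef d l y) = ip P (coef d l y)"
        unfolding Cons by (subst coef_split, subst ip_lin) (simp add: noise_orth y_0)
      have dist: "tree_dist x y = Suc (tree_dist v y)"
        using Cons xy len by (simp add: tree_dist_Cons_left)
      have IHv: "ip (coef d l v) (coef d l y) = tree_corr d l (tree_dist v y)"
        using v xyS Cons by (intro IH) auto
      show ?thesis
      proof (cases v)
        case Nil
        then have "y = []" using len False by (cases y) auto
        have "ip P (coef d l y) = l / d * ip (coef d l v) (coef d l y)"
          by (simp add: P_def Nil ip_def sum_distrib_left mult.assoc)
        then show ?thesis using * IHv dist Nil \<open>y = []\<close> by simp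
      next
        case v': (Cons j u)
        have uS: "u \<in> S" using v v' by (simp add: S_def)
        have IHu: "ip (coef d l u) (coef d l y) = tree_corr d l (tree_dist u y)"
          using uS xyS Cons v' by (intro IH) auto
        have "P = (\<lambda>z. l / (real d - 1) * coef d l v z + (- 1 / (real d - 1)) * coef d l u z)"
          by (simp add: P_def [abs_def] v' fun_eq_iff diff_divide_distrib)
        then have P_y: "ip P (coef d l y) = (l * tree_corr d l (tree_dist v y)
            - tree_corr d l (tree_dist u y)) / (real d - 1)"
          by (simp only: ip_lin IHv IHu) (simp add: diff_divide_distrib)
        show ?thesis
        proof (cases "y = v")
          case True
          have "tree_dist u v = 1"
            using v' by (simp add: tree_dist_commute [of u] tree_dist_Cons_left)
          then have "ip (coef d l x) (coef d l y) = (l - l / d) / (real d - 1)"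
            using * P_y True by simp
          also have "\<dots> = l / d" using d by (simp add: field_simps)
          finally show ?thesis using dist True by simp
        next
          case False
          have "tree_dist v y = Suc (tree_dist u y)"
            by (rule tree_dist_parent [OF xy False v' len]) (use \<open>\<nexists>k. y = k # v\<close> in auto)
          then show ?thesis using * P_y dist by simp
        qed
      qed
    qed
  qed
  have "x \<in> S" "y \<in> S" using less by (auto simp: S_def)
  then have "ip (coef d l x) (coef d l y) = tree_corr d l (tree_dist x y)"
    using wlog [of y x] wlog [of x y] IH ip_commute tree_dist_commute
    by (metis add.commute nat_le_linear)
  then show ?case by (simp add: ip_def S_def)
qed

section \<open>Addresses in a regular tree\<close>

text \<open>A connection from \<open>a\<close> to \<open>b\<close> that avoids \<open>v\<close> can
  be shortened to a path without repetitions, which closes to a cycle through \<open>v\<close>;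
  \<open>a \<noteq> b\<close> makes it long enough.\<close>

lemma graph_cycle_via_vertex:
  assumes E: "sym E" and va: "(v, a) \<in> E" and vb: "(v, b) \<in> E" and ab: "a \<noteq> b"
    and conn: "(a, b) \<in> (E \<inter> (- {v}) \<times> (- {v}))\<^sup>*"
  shows "\<exists>p. graph_cycle E p"
proof -
  define R where "R = E \<inter> (- {v}) \<times> (- {v})"
  define r where "r = (\<lambda>x y. (x, y) \<in> R)"
  have "r\<^sup>*\<^sup>* a b"
    using conn unfolding r_def rtranclp_rtrancl_eq R_def [symmetric] by simp
  then obtain xs0 where "rtrancl_path r a xs0 b"
    by (auto simp: rtranclp_eq_rtrancl_path)
  then obtain xs where xs: "rtrancl_path r a xs b" "distinct (a # xs)"
    by (rule rtrancl_path_distinct)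
  have ne: "xs \<noteq> []" using xs(1) ab by (auto elim: rtrancl_path.cases)
  have step: "((a # xs) ! i, xs ! i) \<in> E" "(a # xs) ! i \<noteq> v" "xs ! i \<noteq> v" if "i < length xs" for i
    using rtrancl_path_nth [OF xs(1) that] by (auto simp: r_def R_def)
  have last: "xs ! (length xs - 1) = b"
    using rtrancl_path_last [OF xs(1) ne] ne by (simp add: last_conv_nth)
  have "v \<notin> set xs" using step(3) by (auto simp: in_set_conv_nth)
  moreover have "a \<noteq> v" using step(2)[of 0] ne by simp
  ultimately have dist: "distinct (v # a # xs)" using xs(2) by auto
  have edges: "((v # a # xs) ! i, (v # a # xs) ! (Suc i mod length (v # a # xs))) \<in> E"
    if i: "i < length (v # a # xs)" for i
  proof -
    consider "i = 0" | k where "i = Suc k" "k < length xs" | "i = Suc (length xs)"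
      using i by (cases i) (auto simp: less_Suc_eq)
    then show ?thesis
    proof cases
      case 1
      then show ?thesis using va by simp
    next
      case 2
      then show ?thesis using step(1)[of k] by simp
    next
      case 3
      then show ?thesis
        using last ne vb E by (simp add: nth_Cons' symD)
    qed
  qed
  have "graph_cycle E (v # a # xs)"
    unfolding graph_cycle_def using dist edges ne by (cases xs) auto
  then show ?thesis ..
qed

text \<open>Vertices are graded by their depth \<open>g\<close>, the distance from \<open>r\<close>.
  Acyclicity gives each vertex other than \<open>r\<close> exactly one neighbour that is not deeper,
  so regularity leaves \<open>d - 1\<close> children, and \<open>d\<close> at \<open>r\<close>.
  Numbering the children of every vertex defines the addressing.\<close>

lemma regular_tree_addresses:
  assumes T: "regular_infinite_tree d V E" and r: "r \<in> V"
  obtains \<phi> where "bij_betw \<phi> {x. address d x} V" and "\<phi> [] = r"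
    and "\<And>x y. address d x \<Longrightarrow> address d y \<Longrightarrow>
      (\<phi> x, \<phi> y) \<in> E \<longleftrightarrow> (\<exists>i. x = i # y) \<or> (\<exists>i. y = i # x)"
proof -
  have EV: "E \<subseteq> V \<times> V" and sym: "sym E" and irr: "irrefl E"
    and conn: "\<And>u v. u \<in> V \<Longrightarrow> v \<in> V \<Longrightarrow> (u, v) \<in> E\<^sup>*"
    and nocyc: "\<nexists>p. graph_cycle E p"
    and fin: "\<And>v. v \<in> V \<Longrightarrow> finite (nbrs E v)"
    and card: "\<And>v. v \<in> V \<Longrightarrow> card (nbrs E v) = d"
    using T by (auto simp: regular_infinite_tree_def tree_graph_def simple_graph_def
        connected_graph_def)
  define g where "g v = (LEAST n. (r, v) \<in> E ^^ n)" for v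
  have g_path: "(r, v) \<in> E ^^ g v" if "v \<in> V" for v
    unfolding g_def using rtrancl_imp_relpow [OF conn [OF r that]] by (rule exE) (rule LeastI)
  have g_le: "g v \<le> n" if "(r, v) \<in> E ^^ n" for v n
    unfolding g_def using that by (rule Least_le)
  have g_r: "g r = 0" using g_le [of r 0] by simp
  have g_0: "v = r" if "v \<in> V" "g v = 0" for v
    using g_path [OF that(1)] that(2) by simp
  have g_edge: "g v \<le> Suc (g u)" if "(u, v) \<in> E" for u v
    using that EV g_path [of u] by (intro g_le) auto
  have g_parent: "\<exists>p. (p, v) \<in> E \<and> g p = n" if "v \<in> V" "g v = Suc n" for v n
  proof -
    have "(r, v) \<in> E ^^ n O E" using g_path [OF that(1)] that(2) by simp
    then obtain p where p: "(r, p) \<in> E ^^ n" "(p, v) \<in> E" by auto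
    then show ?thesis using g_le [OF p(1)] g_edge [OF p(2)] that by auto
  qed
  \<comment> \<open>On a shortest walk from \<open>r\<close> to \<open>w\<close>, all vertices
    before \<open>w\<close> have smaller depth than \<open>w\<close>, hence than
    \<open>v\<close>.\<close>
  have avoid: "(r, w) \<in> (E \<inter> (- {v}) \<times> (- {v}))\<^sup>*" if "w \<in> V" "w \<noteq> v" "g w \<le> g v" for v w
    using that
  proof (induction "g w" arbitrary: w)
    case 0
    then show ?case using g_0 [of w] by simp
  next
    case (Suc n)
    obtain p where p: "(p, w) \<in> E" "g p = n" using g_parent [of w n] Suc by metis
    then have "p \<in> V" "p \<noteq> v" using EV Suc by auto
    then have "(r, p) \<in> (E \<inter> (- {v}) \<times> (- {v}))\<^sup>*" using Suc p by auto
    then show ?case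
      by (rule rtrancl_into_rtrancl) (use p \<open>p \<noteq> v\<close> Suc in auto)
  qed
  \<comment> \<open>Two such neighbours are connected through \<open>r\<close> without passing
    \<open>v\<close>, which would close a cycle at \<open>v\<close>.\<close>
  have unique: "a = b" if "(v, a) \<in> E" "(v, b) \<in> E" "g a \<le> g v" "g b \<le> g v" for v a b
  proof (rule ccontr)
    assume ab: "a \<noteq> b"
    let ?R = "E \<inter> (- {v}) \<times> (- {v})"
    have "a \<in> V" "b \<in> V" "a \<noteq> v" "b \<noteq> v" using that EV irr by (auto simp: irrefl_def)
    then have ra: "(r, a) \<in> ?R\<^sup>*" and rb: "(r, b) \<in> ?R\<^sup>*" using avoid that by auto
    have "sym ?R" using sym by (auto simp: sym_def)
    then have "(a, r) \<in> ?R\<^sup>*" using ra by (metis sym_rtrancl symD)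
    then have "(a, b) \<in> ?R\<^sup>*" using rb by (rule rtrancl_trans)
    then show False using graph_cycle_via_vertex [OF sym that(1,2) ab] nocyc by blast
  qed
  \<comment> \<open>Equal depths are impossible: a neighbour of \<open>v\<close> that is not deeper
    must be the parent supplied by \<open>g_parent\<close>.\<close>
  have nbr_cases: "g u = Suc (g v) \<or> g v = Suc (g u)" if uv: "(v, u) \<in> E" for u v
  proof -
    have uV: "u \<in> V" "v \<in> V" "(u, v) \<in> E" using uv EV sym by (auto dest: symD)
    show ?thesis
    proof (cases "g u \<le> g v")
      case True
      have "g v \<noteq> 0" using g_0 [of u] g_0 [of v] uV True irr by (auto simp: irrefl_def)
      then obtain n where n: "g v = Suc n" by (cases "g v") auto
      then obtain p where "(p, v) \<in> E" "g p = n" using g_parent uV by blast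
      then have "u = p" using unique [of v u p] uv True n sym by (auto dest: symD)
      then show ?thesis using n \<open>g p = n\<close> by simp
    next
      case False
      then show ?thesis using g_edge [OF uv] by simp
    qed
  qed
  define C where "C v = {u. (v, u) \<in> E \<and> g u = Suc (g v)}" for v
  have C_fin: "finite (C v)" if "v \<in> V" for v
    by (rule finite_subset [OF _ fin [OF that]]) (auto simp: C_def nbrs_def)
  have C_r: "card (C r) = d"
  proof -
    have "C r = nbrs E r" using nbr_cases [of r] g_r by (auto simp: C_def nbrs_def)
    then show ?thesis using card r by simp
  qed
  have C_card: "card (C v) = d - 1" if v: "v \<in> V" "v \<noteq> r" for v
  proof -
    obtain n where n: "g v = Suc n" using g_0 v by (cases "g v") auto
    then obtain p where p: "(p, v) \<in> E" "g p = n" using g_parent v by blast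
    have vp: "(v, p) \<in> E" using p sym by (auto dest: symD)
    have "C v = nbrs E v - {p}"
      using nbr_cases [of v] unique [OF _ vp] n p by (fastforce simp: C_def nbrs_def)
    then show ?thesis using card [OF v(1)] vp fin [OF v(1)] by (simp add: nbrs_def)
  qed
  have "\<exists>e. bij_betw e {..<card (C v)} (C v)" if "v \<in> V" for v
    using ex_bij_betw_nat_finite [OF C_fin [OF that]] by (simp add: atLeast0LessThan)
  then obtain e where e: "\<And>v. v \<in> V \<Longrightarrow> bij_betw (e v) {..<card (C v)} (C v)"
    by metis
  \<comment> \<open>The tail of an address is the address of the parent, and \<open>e v i\<close> is
    child number \<open>i\<close> of \<open>v\<close>.\<close>
  define \<phi> where "\<phi> = rec_list r (\<lambda>i (_ :: nat list) v. e v i)"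
  have \<phi>_simps: "\<phi> [] = r" "\<phi> (i # x) = e (\<phi> x) i" for i x
    by (simp_all add: \<phi>_def)
  have n_ch: "num_children d x = card (C (\<phi> x))" if "\<phi> x \<in> V" "g (\<phi> x) = length x" for x
  proof (cases x)
    case (Cons i y)
    then have "\<phi> x \<noteq> r" using that g_r by auto
    then show ?thesis using C_card that Cons by (simp add: num_children_def)
  qed (simp add: num_children_def \<phi>_simps C_r)
  have \<phi>_V: "\<phi> x \<in> V \<and> g (\<phi> x) = length x" if "address d x" for x
    using that
  proof (induction x)
    case Nil
    then show ?case by (simp add: \<phi>_simps r g_r)
  next
    case (Cons i x)
    then have "\<phi> (i # x) \<in> C (\<phi> x)"
      using bij_betwE [OF e [of "\<phi> x"]] n_ch [of x] by (simp add: \<phi>_simps)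
    then show ?case using Cons EV by (auto simp: C_def)
  qed
  have \<phi>_C: "\<phi> (i # x) \<in> C (\<phi> x)" if "address d (i # x)" for i x
    using bij_betwE [OF e [of "\<phi> x"]] n_ch [of x] \<phi>_V [of x] that by (simp add: \<phi>_simps)
  have \<phi>_parent: "u = \<phi> x" if "address d (i # x)" "(u, \<phi> (i # x)) \<in> E" "g u = length x" for i x u
  proof (rule unique)
    show "(\<phi> (i # x), u) \<in> E" "(\<phi> (i # x), \<phi> x) \<in> E"
      using that \<phi>_C [of i x] sym by (auto simp: C_def dest: symD)
    show "g u \<le> g (\<phi> (i # x))" "g (\<phi> x) \<le> g (\<phi> (i # x))"
      using \<phi>_V [of "i # x"] \<phi>_V [of x] that by auto
  qed
  have inj: "x = y" if "address d x" "address d y" "\<phi> x = \<phi> y" for x y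
    using that
  proof (induction x arbitrary: y)
    case Nil
    then have "length y = length ([] :: nat list)" using \<phi>_V [of "[]"] \<phi>_V [of y] by metis
    then show ?case by simp
  next
    case (Cons i x)
    then obtain j w where y: "y = j # w" "length w = length x"
      using \<phi>_V [of "i # x"] \<phi>_V [of y] by (cases y) auto
    have "\<phi> x = \<phi> w"
      by (rule \<phi>_parent [of j]) (use Cons y \<phi>_C [of i x] \<phi>_V [of x] in \<open>auto simp: C_def\<close>)
    moreover from this have "x = w" using Cons y by auto
    moreover have "inj_on (e (\<phi> x)) {..<num_children d x}"
      using e [of "\<phi> x"] \<phi>_V [of x] n_ch [of x] Cons by (auto simp: bij_betw_def)
    ultimately show ?case
      using Cons.prems y by (auto simp: \<phi>_simps inj_on_def)
  qed
  have surj: "\<exists>x. address d x \<and> \<phi> x = v" if "v \<in> V" for v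
    using that
  proof (induction "g v" arbitrary: v)
    case 0
    then show ?case using g_0 [of v] \<phi>_simps(1) by (intro exI [of _ "[]"]) simp
  next
    case (Suc n)
    obtain p where p: "(p, v) \<in> E" "g p = n" using g_parent [of v n] Suc by metis
    then obtain x where x: "address d x" "\<phi> x = p" using Suc EV by blast
    have "v \<in> C (\<phi> x)" using p x Suc by (auto simp: C_def)
    then have "v \<in> e (\<phi> x) ` {..<card (C (\<phi> x))}"
      using e [of "\<phi> x"] \<phi>_V [OF x(1)] by (simp add: bij_betw_def)
    then obtain i where "i < card (C (\<phi> x))" "e (\<phi> x) i = v"
      by blast
    then show ?case using x \<phi>_V [OF x(1)] n_ch [of x]
      by (intro exI [of _ "i # x"]) (simp add: \<phi>_simps)
  qed
  have edge1: "\<exists>i. y = i # x"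
    if xy: "address d x" "address d y" "(\<phi> x, \<phi> y) \<in> E" "g (\<phi> y) = Suc (g (\<phi> x))" for x y
  proof -
    obtain i w where y: "y = i # w" "length w = length x"
      using \<phi>_V [of x] \<phi>_V [of y] xy by (cases y) auto
    then have "\<phi> x = \<phi> w" using \<phi>_parent [of i w "\<phi> x"] xy \<phi>_V [of x] by auto
    then show ?thesis using inj [of x w] xy y by auto
  qed
  show ?thesis
  proof
    show "bij_betw \<phi> {x. address d x} V"
      unfolding bij_betw_def inj_on_def using inj surj \<phi>_V by blast
    show "\<phi> [] = r" by (rule \<phi>_simps)
    fix x y assume xy: "address d x" "address d y"
    show "(\<phi> x, \<phi> y) \<in> E \<longleftrightarrow> (\<exists>i. x = i # y) \<or> (\<exists>i. y = i # x)"
    proof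
      assume E: "(\<phi> x, \<phi> y) \<in> E"
      then have "(\<phi> y, \<phi> x) \<in> E" using sym by (auto dest: symD)
      then show "(\<exists>i. x = i # y) \<or> (\<exists>i. y = i # x)"
        using nbr_cases [OF E] edge1 xy E by blast
    next
      assume "(\<exists>i. x = i # y) \<or> (\<exists>i. y = i # x)"
      then show "(\<phi> x, \<phi> y) \<in> E"
        using \<phi>_C xy symD [OF sym] by (auto simp: C_def)
    qed
  qed
qed

text \<open>\<open>swap_branches i j v\<close> exchanges the branches below the siblings \<open>i # v\<close> and \<open>j # v\<close>.\<close>

fun swap_branches :: "nat \<Rightarrow> nat \<Rightarrow> nat list \<Rightarrow> nat list \<Rightarrow> nat list" where
  "swap_branches i j v [] = []"
| "swap_branches i j v (k # x) =
    (if x = v then (if k = i then j else if k = j then i else k) else k) # swap_branches i j v x"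

lemma swap_branches_short: "length x \<le> length v \<Longrightarrow> swap_branches i j v x = x"
  by (induction x) auto

lemma swap_branches_swap [simp]: "swap_branches i j v (swap_branches i j v x) = x"
proof (induction x)
  case (Cons k x)
  \<comment> \<open>The second application tests the swapped tail against \<open>v\<close>, the
    first one the original tail. The tests agree because \<open>v\<close> itself is fixed and the
    induction hypothesis undoes the swap of \<open>x\<close>.\<close>
  have "swap_branches i j v x = v \<longleftrightarrow> x = v"
    using Cons swap_branches_short [of v v i j, OF order_refl] by metis
  with Cons show ?case by auto
qed simp

lemma address_swap_branches:
  assumes "i < num_children d v" "j < num_children d v" "address d x"
  shows "address d (swap_branches i j v x)"
  using assms(3)
proof (induction x)
  case (Cons k x)
  have "num_children d (swap_branches i j v x) = num_children d x"
    by (cases x) (auto simp: num_children_def)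
  with Cons assms show ?case by auto
qed simp

lemma swap_branches_Cons: "\<exists>k'. swap_branches i j v (k # x) = k' # swap_branches i j v x"
  by simp

text \<open>The root \<open>\<phi> []\<close> is left arbitrary: one root suffices for existence,
  whereas uniqueness needs every vertex as root.\<close>

locale tree_addresses =
  fixes d :: nat and V :: "'v set" and E :: "('v \<times> 'v) set" and \<phi> :: "nat list \<Rightarrow> 'v"
  assumes EV: "E \<subseteq> V \<times> V"
    and bij: "bij_betw \<phi> {x. address d x} V"
    and edge_iff: "\<And>x y. address d x \<Longrightarrow> address d y \<Longrightarrow>
      (\<phi> x, \<phi> y) \<in> E \<longleftrightarrow> (\<exists>i. x = i # y) \<or> (\<exists>i. y = i # x)"
begin

section \<open>Neighbourhoods, automorphisms and distances in an addressed tree\<close>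

definition \<psi> :: "'v \<Rightarrow> nat list" where
  "\<psi> = inv_into {x. address d x} \<phi>"

lemma \<phi>_in_V: "address d x \<Longrightarrow> \<phi> x \<in> V"
  using bij by (auto simp: bij_betw_def)

lemma \<psi>_\<phi> [simp]: "address d x \<Longrightarrow> \<psi> (\<phi> x) = x"
  unfolding \<psi>_def using bij by (simp add: bij_betw_def)

lemma \<phi>_\<psi> [simp]: "v \<in> V \<Longrightarrow> \<phi> (\<psi> v) = v"
  unfolding \<psi>_def using bij by (simp add: bij_betw_def f_inv_into_f)

lemma address_\<psi> [simp]: "v \<in> V \<Longrightarrow> address d (\<psi> v)"
  unfolding \<psi>_def using bij inv_into_into [of v \<phi> "{x. address d x}"] by (auto simp: bij_betw_def)

lemma nbrs_\<phi>:
  assumes x: "address d x"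
  shows "nbrs E (\<phi> x) = \<phi> ` ((\<lambda>i. i # x) ` {..<num_children d x} \<union> (if x = [] then {} else {tl x}))"
    (is "_ = \<phi> ` ?A")
proof -
  have A: "y \<in> ?A \<longleftrightarrow> (\<exists>i. x = i # y) \<or> (\<exists>i. y = i # x)" if "address d y" for y
    using that by (cases x) auto
  have A': "address d y" if "y \<in> ?A" for y
    using that x by (cases x) auto
  show ?thesis
  proof (intro set_eqI iffI)
    fix u assume u: "u \<in> nbrs E (\<phi> x)"
    then have uV: "u \<in> V" using EV by (auto simp: nbrs_def)
    then have "\<psi> u \<in> ?A"
      using edge_iff [OF x address_\<psi> [OF uV]] u by (subst A) (auto simp: nbrs_def)
    then show "u \<in> \<phi> ` ?A" using uV by (metis \<phi>_\<psi> imageI)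
  next
    fix u assume "u \<in> \<phi> ` ?A"
    then obtain y where y: "y \<in> ?A" "u = \<phi> y" by blast
    then show "u \<in> nbrs E (\<phi> x)"
      using A A' edge_iff [OF x] by (auto simp: nbrs_def)
  qed
qed

lemma sum_nbrs_\<phi>:
  assumes x: "address d x"
  shows "(\<Sum>u\<in>nbrs E (\<phi> x). f u)
    = (\<Sum>i<num_children d x. f (\<phi> (i # x))) + (if x = [] then 0 else f (\<phi> (tl x)) :: real)"
proof -
  let ?A = "(\<lambda>i. i # x) ` {..<num_children d x}" and ?B = "if x = [] then {} else {tl x}"
  have "address d y" if "y \<in> ?A \<union> ?B" for y
    using that x by (cases x) auto
  then have inj: "inj_on \<phi> (?A \<union> ?B)"
    using bij unfolding bij_betw_def by (blast intro: inj_on_subset)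
  have disj: "?A \<inter> ?B = {}" by (cases x) auto
  have "(\<Sum>u\<in>nbrs E (\<phi> x). f u) = (\<Sum>y\<in>?A \<union> ?B. f (\<phi> y))"
    unfolding nbrs_\<phi> [OF x] using inj by (simp add: sum.reindex)
  also have "\<dots> = (\<Sum>y\<in>?A. f (\<phi> y)) + (\<Sum>y\<in>?B. f (\<phi> y))"
    using disj by (intro sum.union_disjoint) auto
  also have "(\<Sum>y\<in>?A. f (\<phi> y)) = (\<Sum>i<num_children d x. f (\<phi> (i # x)))"
    by (subst sum.reindex) (auto simp: inj_on_def)
  finally show ?thesis by simp
qed

text \<open>The swap of two sibling branches is its own inverse, so mapping edges to edges already
  yields both bijectivity and the equivalence for edges.\<close>

lemma sibling_automorphism:
  assumes ij: "i < num_children d v" "j < num_children d v" and v: "address d v"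
  obtains \<Phi> where "\<Phi> \<in> graph_aut V E" "\<Phi> (\<phi> []) = \<phi> []" "\<Phi> (\<phi> (i # v)) = \<phi> (j # v)"
proof
  let ?s = "swap_branches i j v"
  define \<Phi> where "\<Phi> u = \<phi> (?s (\<psi> u))" for u
  have s: "address d (?s x)" if "address d x" for x
    by (rule address_swap_branches [OF ij that])
  have \<Phi>V: "\<Phi> u \<in> V" if "u \<in> V" for u
    unfolding \<Phi>_def using that by (intro \<phi>_in_V s) simp
  have \<Phi>\<Phi>: "\<Phi> (\<Phi> u) = u" if "u \<in> V" for u
    unfolding \<Phi>_def using that by (simp add: s)
  have edge: "(\<Phi> u, \<Phi> w) \<in> E" if "(u, w) \<in> E" for u w
  proof -
    have uw: "u \<in> V" "w \<in> V" using that EV by auto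
    then have "(\<exists>i. \<psi> u = i # \<psi> w) \<or> (\<exists>i. \<psi> w = i # \<psi> u)"
      using edge_iff [of "\<psi> u" "\<psi> w"] that by simp
    then have "(\<exists>i. ?s (\<psi> u) = i # ?s (\<psi> w)) \<or> (\<exists>i. ?s (\<psi> w) = i # ?s (\<psi> u))"
      by (metis swap_branches_Cons)
    then show ?thesis
      unfolding \<Phi>_def using edge_iff s uw by simp
  qed
  have "bij_betw \<Phi> V V"
    by (rule bij_betw_byWitness [where f' = \<Phi>]) (use \<Phi>V \<Phi>\<Phi> in auto)
  moreover have "(\<Phi> u, \<Phi> w) \<in> E \<longleftrightarrow> (u, w) \<in> E" if "u \<in> V" "w \<in> V" for u w
    using edge [of u w] edge [of "\<Phi> u" "\<Phi> w"] \<Phi>\<Phi> that by auto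
  ultimately show "\<Phi> \<in> graph_aut V E" by (simp add: graph_aut_def)
  show "\<Phi> (\<phi> []) = \<phi> []" by (simp add: \<Phi>_def)
  show "\<Phi> (\<phi> (i # v)) = \<phi> (j # v)"
    using ij v by (simp add: \<Phi>_def swap_branches_short)
qed

text \<open>Together with \<open>tree_dist_path\<close> this identifies \<open>tree_dist\<close>
  with the length of a shortest walk, a notion that depends on \<open>E\<close> alone.\<close>

lemma tree_dist_le:
  "(\<phi> x, \<phi> y) \<in> E ^^ n \<Longrightarrow> address d x \<Longrightarrow> address d y \<Longrightarrow> tree_dist x y \<le> n"
proof (induction n arbitrary: y)
  case 0
  from 0(1) have "\<phi> x = \<phi> y" by simp
  then have "x = y" using \<psi>_\<phi> 0(2,3) by metis
  then show ?case by simp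
next
  case (Suc n)
  then obtain w where w: "(\<phi> x, w) \<in> E ^^ n" "(w, \<phi> y) \<in> E" by auto
  then have wV: "w \<in> V" using EV by auto
  then have "tree_dist x (\<psi> w) \<le> n" using Suc.IH [of "\<psi> w"] Suc.prems w by simp
  moreover have "(\<exists>i. \<psi> w = i # y) \<or> (\<exists>i. y = i # \<psi> w)"
    using edge_iff [of "\<psi> w" y] w wV Suc by simp
  then have "tree_dist x y \<le> Suc (tree_dist x (\<psi> w))"
    using tree_dist_Cons_right_cases [of x _ y] tree_dist_Cons_right_cases [of x _ "\<psi> w"]
    by (metis le_SucI nat_le_linear not_less_eq_eq)
  ultimately show ?case by simp
qed

lemma tree_dist_path:
  "address d x \<Longrightarrow> address d y \<Longrightarrow> (\<phi> x, \<phi> y) \<in> E ^^ tree_dist x y"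
proof (induction x y rule: tree_dist.induct)
  case (1 x y)
  consider "x = y" | "x \<noteq> y" "length y \<le> length x" | "x \<noteq> y" "\<not> length y \<le> length x" by blast
  then show ?case
  proof cases
    case 2
    then obtain i v where x: "x = i # v" by (cases x) auto
    then have "(\<phi> x, \<phi> (tl x)) \<in> E" "(\<phi> (tl x), \<phi> y) \<in> E ^^ tree_dist (tl x) y"
      using 1 2 edge_iff [of x v] by auto
    then have "(\<phi> x, \<phi> y) \<in> E ^^ Suc (tree_dist (tl x) y)" by (rule relpow_Suc_I2)
    moreover have "tree_dist x y = Suc (tree_dist (tl x) y)"
      using 2 by (subst tree_dist.simps) auto
    ultimately show ?thesis by (simp only:)
  next
    case 3
    then obtain i v where y: "y = i # v" by (cases y) auto
    then have "(\<phi> x, \<phi> (tl y)) \<in> E ^^ tree_dist x (tl y)" "(\<phi> (tl y), \<phi> y) \<in> E"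
      using 1 3 edge_iff [of v y] by auto
    then have "(\<phi> x, \<phi> y) \<in> E ^^ Suc (tree_dist x (tl y))" by (rule relpow_Suc_I)
    moreover have "tree_dist x y = Suc (tree_dist x (tl y))"
      using 3 by (subst tree_dist.simps) auto
    ultimately show ?thesis by (simp only:)
  qed simp
qed

text \<open>Automorphisms map walks to walks, so they cannot increase distances; neither can their
  inverses.\<close>

lemma tree_dist_automorphism:
  assumes \<Phi>: "\<Phi> \<in> graph_aut V E" and uw: "u \<in> V" "w \<in> V"
  shows "tree_dist (\<psi> (\<Phi> u)) (\<psi> (\<Phi> w)) = tree_dist (\<psi> u) (\<psi> w)"
proof -
  have le: "tree_dist (\<psi> (\<Phi> u)) (\<psi> (\<Phi> w)) \<le> tree_dist (\<psi> u) (\<psi> w)"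
    if \<Phi>: "\<Phi> \<in> graph_aut V E" and uw: "u \<in> V" "w \<in> V" for \<Phi> u w
  proof -
    have \<Phi>V: "\<Phi> x \<in> V" if "x \<in> V" for x
      using \<Phi> that by (auto simp: graph_aut_def bij_betw_def)
    have path: "(\<Phi> u, \<Phi> w) \<in> E ^^ n" if "(u, w) \<in> E ^^ n" for w n
      using that
    proof (induction n arbitrary: w)
      case (Suc n)
      then obtain x where x: "(u, x) \<in> E ^^ n" "(x, w) \<in> E" by auto
      then have "(\<Phi> x, \<Phi> w) \<in> E" using \<Phi> EV by (auto simp: graph_aut_def)
      then show ?case using Suc.IH [OF x(1)] by auto
    qed simp
    show ?thesis
      using path [of w "tree_dist (\<psi> u) (\<psi> w)"] tree_dist_path [of "\<psi> u" "\<psi> w"] uw \<Phi>V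
      by (intro tree_dist_le) auto
  qed
  have \<Phi>V: "\<Phi> x \<in> V" if "x \<in> V" for x
    using \<Phi> that by (auto simp: graph_aut_def bij_betw_def)
  define \<Psi> where "\<Psi> = inv_into V \<Phi>"
  have \<Psi>: "bij_betw \<Psi> V V" and \<Psi>\<Phi>: "\<And>x. x \<in> V \<Longrightarrow> \<Psi> (\<Phi> x) = x"
    and \<Phi>\<Psi>: "\<And>x. x \<in> V \<Longrightarrow> \<Phi> (\<Psi> x) = x"
    using \<Phi> by (auto simp: graph_aut_def \<Psi>_def bij_betw_inv_into bij_betw_inv_into_left
        bij_betw_inv_into_right)
  have "\<Psi> \<in> graph_aut V E"
    using \<Psi> \<Phi> \<Phi>\<Psi> unfolding graph_aut_def by (auto simp: bij_betw_def) (metis imageI)+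
  then show ?thesis
    using le [OF \<Phi> uw] le [of \<Psi> "\<Phi> u" "\<Phi> w"] \<Psi>\<Phi> \<Phi>V uw by simp
qed

end

section \<open>Covariances determine Gaussian laws\<close>

lemma (in finite_measure) integrable_cis:
  "f \<in> borel_measurable M \<Longrightarrow> integrable M (\<lambda>x. cis (f x))"
  by (rule integrable_const_bound [where B = 1]) (auto simp: cis_conv_exp)

text \<open>The frequency 0 shows that the total masses agree. Dividing by them reduces the claim to
  Levy's uniqueness theorem; mass 0 is trivial.\<close>

lemma measure_vimage_eq_of_char:
  fixes Y :: "'a \<Rightarrow> real" and Y' :: "'b \<Rightarrow> real"
  assumes M: "finite_measure M" and M': "finite_measure M'"
    and Y [measurable]: "Y \<in> borel_measurable M" and Y' [measurable]: "Y' \<in> borel_measurable M'"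
    and char: "\<And>s. (\<integral>x. cis (s * Y x) \<partial>M) = (\<integral>x. cis (s * Y' x) \<partial>M')"
    and B [measurable]: "B \<in> sets borel"
  shows "measure M (Y -` B \<inter> space M) = measure M' (Y' -` B \<inter> space M')"
proof -
  interpret M: finite_measure M by fact
  interpret M': finite_measure M' by fact
  define m where "m = measure M (space M)"
  have m': "m = measure M' (space M')"
    using char [of 0] by (simp add: m_def)
  show ?thesis
  proof (cases "m = 0")
    case True
    then show ?thesis
      using M.bounded_measure [of "Y -` B \<inter> space M"] M'.bounded_measure [of "Y' -` B \<inter> space M'"]
      by (metis m_def m' measure_nonneg order_antisym)
  next
    case False
    then have m: "m > 0" by (simp add: m_def less_le)
    \<comment> \<open>Stated for an arbitrary sample space, because \<open>M\<close> and
      \<open>M'\<close> live on different ones.\<close>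
    have law: "real_distribution (distr (density N (\<lambda>_. ennreal (1 / m))) borel Z)"
      "char (distr (density N (\<lambda>_. ennreal (1 / m))) borel Z) s = (\<integral>x. cis (s * Z x) \<partial>N) / m"
      "measure (distr (density N (\<lambda>_. ennreal (1 / m))) borel Z) B = measure N (Z -` B \<inter> space N) / m"
      if N: "finite_measure N" "m = measure N (space N)" and Z [measurable]: "Z \<in> borel_measurable N"
      for N :: "'c measure" and Z s
    proof -
      interpret N: finite_measure N by fact
      have "emeasure (density N (\<lambda>_. ennreal (1 / m))) (space N) = 1"
        using m by (simp add: emeasure_density_const N.emeasure_eq_measure N(2) [symmetric]
            flip: ennreal_mult)
      then interpret D: prob_space "density N (\<lambda>_. ennreal (1 / m))"
        by (intro prob_spaceI) simp
      show "real_distribution (distr (density N (\<lambda>_. ennreal (1 / m))) borel Z)"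
        by (rule D.real_distribution_distr) simp
      show "char (distr (density N (\<lambda>_. ennreal (1 / m))) borel Z) s = (\<integral>x. cis (s * Z x) \<partial>N) / m"
        unfolding char_def using m
        by (subst integral_distr) (auto simp: integral_density cis_conv_exp scaleR_conv_of_real)
      show "measure (distr (density N (\<lambda>_. ennreal (1 / m))) borel Z) B
          = measure N (Z -` B \<inter> space N) / m"
        using m by (simp add: measure_distr measure_density_const)
    qed
    have "distr (density M (\<lambda>_. ennreal (1 / m))) borel Y = distr (density M' (\<lambda>_. ennreal (1 / m))) borel Y'"
      using law(1,2) [OF M m_def Y] law(1,2) [OF M' m' Y'] char
      by (intro Levy_uniqueness ext) simp_all
    then show ?thesis
      using law(3) [OF M m_def Y] law(3) [OF M' m' Y'] m by simp
  qed
qed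

text \<open>The nonnegative weight \<open>1 + cos (S + \<theta>)\<close> turns the joint characteristic function of
  \<open>(S, Y)\<close> into characteristic functions of \<open>Y\<close> under finite measures, to which the one-dimensional
  uniqueness theorem applies.\<close>

lemma (in finite_measure) char_cos_weight:
  assumes [measurable]: "S \<in> borel_measurable M" "Y \<in> borel_measurable M"
  shows "(\<integral>x. cis (s * Y x) \<partial>density M (\<lambda>x. ennreal (1 + cos (S x + \<theta>))))
    = (\<integral>x. cis (s * Y x) \<partial>M) + cis \<theta> / 2 * (\<integral>x. cis (S x + s * Y x) \<partial>M)
      + cis (- \<theta>) / 2 * (\<integral>x. cis (- S x + s * Y x) \<partial>M)"
proof -
  have nn: "0 \<le> 1 + cos (S x + \<theta>)" for x
    using cos_ge_minus_one [of "S x + \<theta>"] by linarith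
  have cos: "complex_of_real (cos u) = (cis u + cis (- u)) / 2" for u
    by (simp add: complex_eq_iff)
  have int: "integrable M (\<lambda>x. cis (s * Y x))" "integrable M (\<lambda>x. cis (S x + s * Y x))"
    "integrable M (\<lambda>x. cis (s * Y x - S x))"
    by (rule integrable_cis; measurable)+
  have "(\<integral>x. cis (s * Y x) \<partial>density M (\<lambda>x. ennreal (1 + cos (S x + \<theta>))))
      = (\<integral>x. (1 + cos (S x + \<theta>)) *\<^sub>R cis (s * Y x) \<partial>M)"
    by (rule integral_density) (auto simp: nn cis_conv_exp)
  also have "\<dots> = (\<integral>x. cis (s * Y x) + cis \<theta> / 2 * cis (S x + s * Y x)
      + cis (- \<theta>) / 2 * cis (- S x + s * Y x) \<partial>M)"
    by (intro Bochner_Integration.integral_cong refl)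
      (simp add: scaleR_conv_of_real cos ring_distribs cis_mult add_divide_distrib algebra_simps)
  also have "\<dots> = (\<integral>x. cis (s * Y x) \<partial>M) + cis \<theta> / 2 * (\<integral>x. cis (S x + s * Y x) \<partial>M)
      + cis (- \<theta>) / 2 * (\<integral>x. cis (- S x + s * Y x) \<partial>M)"
    by (simp add: int)
  finally show ?thesis .
qed

lemma (in finite_measure) measure_cos_weight:
  assumes [measurable]: "S \<in> borel_measurable M" "Y \<in> borel_measurable M" "B \<in> sets borel"
  shows "measure (density M (\<lambda>x. ennreal (1 + cos (S x + \<theta>)))) (Y -` B \<inter> space M)
    = measure M (Y -` B \<inter> space M) + (\<integral>x. indicator B (Y x) * cos (S x + \<theta>) \<partial>M)"
proof -
  have nn: "0 \<le> 1 + cos (S x + \<theta>)" for x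
    using cos_ge_minus_one [of "S x + \<theta>"] by linarith
  let ?B = "Y -` B \<inter> space M"
  have "measure (density M (\<lambda>x. ennreal (1 + cos (S x + \<theta>)))) ?B
      = (\<integral>x. indicator ?B x \<partial>density M (\<lambda>x. ennreal (1 + cos (S x + \<theta>))))"
    by simp
  also have "\<dots> = (\<integral>x. (1 + cos (S x + \<theta>)) *\<^sub>R indicator ?B x \<partial>M)"
    by (rule integral_density) (auto simp: nn)
  also have "\<dots> = (\<integral>x. indicator ?B x + indicator B (Y x) * cos (S x + \<theta>) \<partial>M)"
    by (intro Bochner_Integration.integral_cong refl) (simp add: indicator_def)
  also have "\<dots> = measure M ?B + (\<integral>x. indicator B (Y x) * cos (S x + \<theta>) \<partial>M)"
    by (subst Bochner_Integration.integral_add)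
      (auto intro!: integrable_const_bound [where B = 1] simp: indicator_def)
  finally show ?thesis .
qed

text \<open>The phase \<open>- pi / 2\<close> turns the cosine into a sine, so two weights recover
  real and imaginary part.\<close>

lemma (in finite_measure) integral_indicator_cis:
  assumes [measurable]: "S \<in> borel_measurable M" "Y \<in> borel_measurable M" "B \<in> sets borel"
  shows "(\<integral>x. indicator B (Y x) *\<^sub>R cis (S x) \<partial>M)
    = Complex (\<integral>x. indicator B (Y x) * cos (S x + 0) \<partial>M)
        (\<integral>x. indicator B (Y x) * cos (S x + - pi / 2) \<partial>M)"
proof -
  have "integrable M (\<lambda>x. indicator B (Y x) *\<^sub>R cis (S x))"
    by (rule integrable_const_bound [where B = 1]) (auto simp: cis_conv_exp indicator_def)
  then show ?thesis
    by (simp add: complex_eq_iff cos_diff flip: integral_Re integral_Im)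
qed

lemma finite_measure_cos_weight:
  assumes "finite_measure M" and [measurable]: "S \<in> borel_measurable M"
  shows "finite_measure (density M (\<lambda>x. ennreal (1 + cos (S x + \<theta>))))"
proof -
  interpret finite_measure M by fact
  show ?thesis
  proof (rule finite_measureI)
    have "1 + cos (S x + \<theta>) \<le> 2" for x
      using cos_le_one [of "S x + \<theta>"] by linarith
    then have "(\<integral>\<^sup>+x. ennreal (1 + cos (S x + \<theta>)) * indicator (space M) x \<partial>M)
        \<le> (\<integral>\<^sup>+x. 2 \<partial>M)"
      by (intro nn_integral_mono) (auto simp: indicator_def ennreal_le_iff2 simp flip: ennreal_numeral)
    also have "\<dots> < \<infinity>"
      by (simp add: less_top [symmetric] ennreal_mult_eq_top_iff)
    finally show "emeasure (density M (\<lambda>x. ennreal (1 + cos (S x + \<theta>))))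
        (space (density M (\<lambda>x. ennreal (1 + cos (S x + \<theta>))))) \<noteq> \<infinity>"
      by (simp add: emeasure_density)
  qed
qed

text \<open>The weight \<open>1 + cos (S x + \<theta>)\<close> contains the frequencies -1, 0 and 1
  of \<open>S\<close>, hence the three values of \<open>c\<close>. Subtracting the unweighted
  measure of the event leaves the cosine integral over it.\<close>

lemma integral_indicator_cis_eq:
  fixes Y :: "'a \<Rightarrow> real" and Y' :: "'b \<Rightarrow> real"
  assumes M: "finite_measure M" and M': "finite_measure M'"
    and [measurable]: "S \<in> borel_measurable M" "Y \<in> borel_measurable M"
      "S' \<in> borel_measurable M'" "Y' \<in> borel_measurable M'" "B \<in> sets borel"
    and char: "\<And>c s. c \<in> {- 1, 0, 1} \<Longrightarrow>
      (\<integral>x. cis (c * S x + s * Y x) \<partial>M) = (\<integral>x. cis (c * S' x + s * Y' x) \<partial>M')"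
  shows "(\<integral>x. indicator B (Y x) *\<^sub>R cis (S x) \<partial>M) = (\<integral>x. indicator B (Y' x) *\<^sub>R cis (S' x) \<partial>M')"
proof -
  interpret M: finite_measure M by fact
  interpret M': finite_measure M' by fact
  have "measure M (Y -` B \<inter> space M) = measure M' (Y' -` B \<inter> space M')"
    using char [of 0] by (intro measure_vimage_eq_of_char M M') auto
  moreover have "measure (density M (\<lambda>x. ennreal (1 + cos (S x + \<theta>)))) (Y -` B \<inter> space M)
      = measure (density M' (\<lambda>x. ennreal (1 + cos (S' x + \<theta>)))) (Y' -` B \<inter> space M')" for \<theta>
    using measure_vimage_eq_of_char [OF finite_measure_cos_weight [OF M, of S \<theta>]
        finite_measure_cos_weight [OF M', of S' \<theta>], of Y Y' B]
      char [of 0] char [of 1] char [of "-1"]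
    by (simp add: M.char_cos_weight M'.char_cos_weight)
  ultimately have "(\<integral>x. indicator B (Y x) * cos (S x + \<theta>) \<partial>M)
      = (\<integral>x. indicator B (Y' x) * cos (S' x + \<theta>) \<partial>M')" for \<theta>
    by (simp add: M.measure_cos_weight M'.measure_cos_weight)
  then show ?thesis
    by (simp only: M.integral_indicator_cis M'.integral_indicator_cis assms)
qed

text \<open>Restriction to an event, written as a density with a real-valued weight so that
  \<open>integral_density\<close> applies to it.\<close>

lemma restricted_measure:
  assumes M: "finite_measure M" and [measurable]: "S \<in> sets M"
  defines "N \<equiv> density M (\<lambda>x. ennreal (indicator S x))"
  shows "finite_measure N" and "space N = space M" and "sets N = sets M"
    and "C \<in> sets M \<Longrightarrow> measure N C = measure M (S \<inter> C)"
    and "f \<in> borel_measurable M \<Longrightarrow>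
      (\<integral>x. f x \<partial>N) = (\<integral>x. indicator S x *\<^sub>R (f x :: 'c :: {banach, second_countable_topology}) \<partial>M)"
proof -
  interpret finite_measure M by fact
  have N: "N = density M (indicator S)"
    unfolding N_def by (simp add: ennreal_indicator)
  have e: "emeasure N C = emeasure M (S \<inter> C)" if "C \<in> sets M" for C
    using that unfolding N by (intro emeasure_restricted) auto
  show "space N = space M" "sets N = sets M" by (simp_all add: N)
  show "finite_measure N"
    by (rule finite_measureI) (use e [of "space M"] \<open>space N = space M\<close> in simp)
  show "measure N C = measure M (S \<inter> C)" if "C \<in> sets M"
    using e [OF that] by (simp add: measure_def)
  show "(\<integral>x. f x \<partial>N) = (\<integral>x. indicator S x *\<^sub>R f x \<partial>M)" if "f \<in> borel_measurable M"
    unfolding N_def using that by (intro integral_density) auto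
qed

text \<open>Restricting both measures to the events for one coordinate removes that coordinate, and
  by \<open>integral_indicator_cis_eq\<close> the characteristic functions of the remaining ones
  still agree. The induction therefore generalises over the measures. With no coordinates left, the
  hypothesis compares total masses.\<close>

lemma cramer_wold:
  fixes X :: "'i \<Rightarrow> 'a \<Rightarrow> real" and X' :: "'i \<Rightarrow> 'b \<Rightarrow> real"
  assumes "finite K" "finite_measure M" "finite_measure M'"
    and "\<And>k. k \<in> K \<Longrightarrow> X k \<in> borel_measurable M" "\<And>k. k \<in> K \<Longrightarrow> X' k \<in> borel_measurable M'"
    and "\<And>k. k \<in> K \<Longrightarrow> A k \<in> sets borel"
    and "\<And>t. (\<integral>x. cis (\<Sum>k\<in>K. t k * X k x) \<partial>M) = (\<integral>x. cis (\<Sum>k\<in>K. t k * X' k x) \<partial>M')"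
  shows "measure M {x \<in> space M. \<forall>k\<in>K. X k x \<in> A k} = measure M' {x \<in> space M'. \<forall>k\<in>K. X' k x \<in> A k}"
  using assms
proof (induction K arbitrary: M M' rule: finite_induct)
  case empty
  interpret M: finite_measure M by fact
  interpret M': finite_measure M' by fact
  show ?case using empty(6) by simp
next
  case (insert k K)
  have [measurable]: "X k \<in> borel_measurable M" "X' k \<in> borel_measurable M'" "A k \<in> sets borel"
    using insert by auto
  define B where "B = X k -` A k \<inter> space M"
  define B' where "B' = X' k -` A k \<inter> space M'"
  have B [measurable]: "B \<in> sets M" "B' \<in> sets M'"
    unfolding B_def B'_def by measurable
  define N where "N = density M (\<lambda>x. ennreal (indicator B x))"
  define N' where "N' = density M' (\<lambda>x. ennreal (indicator B' x))"
  note N = restricted_measure [OF insert.prems(1) B(1), folded N_def]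
  note N' = restricted_measure [OF insert.prems(2) B(2), folded N'_def]
  have "measure N {x \<in> space N. \<forall>j\<in>K. X j x \<in> A j} = measure N' {x \<in> space N'. \<forall>j\<in>K. X' j x \<in> A j}"
  proof (rule insert.IH [OF N(1) N'(1)])
    fix t :: "'i \<Rightarrow> real"
    define S where "S x = (\<Sum>j\<in>K. t j * X j x)" for x
    define S' where "S' x = (\<Sum>j\<in>K. t j * X' j x)" for x
    have [measurable]: "S \<in> borel_measurable M" "S' \<in> borel_measurable M'"
      unfolding S_def S'_def using insert.prems
      by (auto intro!: borel_measurable_sum borel_measurable_times)
    have "(\<integral>x. cis (c * S x + s * X k x) \<partial>M) = (\<integral>x. cis (c * S' x + s * X' k x) \<partial>M')" for c s
    proof -
      \<comment> \<open>This choice of \<open>t\<close> turns the joint characteristic function of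
        the partial sum and \<open>X k\<close> into an instance of the hypothesis.\<close>
      have "(\<Sum>j\<in>insert k K. (if j = k then s else c * t j) * f j) = c * (\<Sum>j\<in>K. t j * f j) + s * f k"
        for f :: "'i \<Rightarrow> real"
        using insert(1,2) by (auto simp: sum_distrib_left mult.assoc intro!: sum.cong)
      then show ?thesis
        using insert.prems(6) [of "\<lambda>j. if j = k then s else c * t j"] by (simp only: S_def S'_def)
    qed
    then have eq: "(\<integral>x. indicator (A k) (X k x) *\<^sub>R cis (S x) \<partial>M)
        = (\<integral>x. indicator (A k) (X' k x) *\<^sub>R cis (S' x) \<partial>M')"
      using insert.prems(1,2) by (intro integral_indicator_cis_eq) auto
    have "(\<integral>x. cis (S x) \<partial>N) = (\<integral>x. indicator (A k) (X k x) *\<^sub>R cis (S x) \<partial>M)"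
      by (subst N(5)) (auto simp: B_def indicator_def cis_conv_exp intro!: Bochner_Integration.integral_cong)
    moreover have "(\<integral>x. cis (S' x) \<partial>N') = (\<integral>x. indicator (A k) (X' k x) *\<^sub>R cis (S' x) \<partial>M')"
      by (subst N'(5)) (auto simp: B'_def indicator_def cis_conv_exp intro!: Bochner_Integration.integral_cong)
    ultimately show "(\<integral>x. cis (\<Sum>j\<in>K. t j * X j x) \<partial>N) = (\<integral>x. cis (\<Sum>j\<in>K. t j * X' j x) \<partial>N')"
      using eq by (simp only: S_def S'_def)
  next
    fix j assume "j \<in> K"
    then have "X j \<in> borel_measurable M" "X' j \<in> borel_measurable M'" using insert.prems by auto
    then show "X j \<in> borel_measurable N" "X' j \<in> borel_measurable N'"
      by (simp_all add: N_def N'_def)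
  qed (use insert in auto)
  moreover have "{x \<in> space M. \<forall>j\<in>K. X j x \<in> A j} \<in> sets M"
    using insert.hyps insert.prems by (intro sets.sets_Collect_finite_All ) auto
  moreover have "{x \<in> space M'. \<forall>j\<in>K. X' j x \<in> A j} \<in> sets M'"
    using insert.hyps insert.prems by (intro sets.sets_Collect_finite_All) auto
  moreover have "{x \<in> space M. \<forall>j\<in>insert k K. X j x \<in> A j} = B \<inter> {x \<in> space M. \<forall>j\<in>K. X j x \<in> A j}"
    "{x \<in> space M'. \<forall>j\<in>insert k K. X' j x \<in> A j} = B' \<inter> {x \<in> space M'. \<forall>j\<in>K. X' j x \<in> A j}"
    by (auto simp: B_def B'_def)
  ultimately show ?case
    by (simp only: N(2,4) N'(2,4))
qed

text \<open>A nondegenerate \<open>Y\<close> is \<open>\<sigma>\<close> times a standard normal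
  variable, whose characteristic function is evaluated at \<open>\<sigma>\<close>. In the degenerate
  case the mean forces \<open>Y\<close> to vanish almost surely, and the same formula reads 1 =
  1.\<close>

lemma (in prob_space) centered_gaussian:
  assumes G: "gaussian_rv M Y" and E: "expectation Y = 0"
  shows "integrable M (\<lambda>x. (Y x)\<^sup>2)" and "(\<integral>x. cis (Y x) \<partial>M) = exp (- expectation (\<lambda>x. (Y x)\<^sup>2) / 2)"
proof -
  have [measurable]: "Y \<in> borel_measurable M" using G by (simp add: gaussian_rv_def)
  consider \<mu> \<sigma> where "0 < \<sigma>" "distributed M lborel Y (normal_density \<mu> \<sigma>)" | \<mu> where "AE x in M. Y x = \<mu>"
    using G by (auto simp: gaussian_rv_def)
  then have "integrable M (\<lambda>x. (Y x)\<^sup>2) \<and> (\<integral>x. cis (Y x) \<partial>M) = exp (- expectation (\<lambda>x. (Y x)\<^sup>2) / 2)"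
  proof cases
    case 1
    have \<mu>: "\<mu> = 0" using normal_distributed_expectation [OF 1] E by simp
    have D: "distributed M lborel (\<lambda>x. Y x / \<sigma>) std_normal_density"
      using normal_standard_normal_convert [OF 1(1), of Y \<mu>] 1(2) \<mu> by simp
    have "integrable M (\<lambda>x. (Y x)\<^sup>2)"
      using integrable_normal_moment [OF 1(1), of \<mu> 2] \<mu>
      by (subst distributed_integrable [OF 1(2), symmetric]) auto
    moreover have "expectation (\<lambda>x. (Y x)\<^sup>2) = \<sigma>\<^sup>2"
      using normal_distributed_variance [OF 1] E by simp
    moreover have "(\<integral>x. cis (Y x) \<partial>M) = char std_normal_distribution \<sigma>"
    proof -
      have "std_normal_distribution = distr M lborel (\<lambda>x. Y x / \<sigma>)"
        using D by (simp add: distributed_distr_eq_density)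
      then have "char std_normal_distribution \<sigma> = (\<integral>x. cis (\<sigma> * (Y x / \<sigma>)) \<partial>M)"
        unfolding char_def by (simp only: cis_conv_exp) (subst integral_distr; simp)
      then show ?thesis using 1(1) by simp
    qed
    ultimately show ?thesis by (simp add: char_std_normal_distribution)
  next
    case 2
    have "expectation Y = expectation (\<lambda>_. \<mu>)"
      using 2 by (intro integral_cong_AE) auto
    then have \<mu>: "\<mu> = 0" using E by (simp add: prob_space)
    have sq: "AE x in M. (Y x)\<^sup>2 = 0" using 2 \<mu> by auto
    have "integrable M (\<lambda>x. (Y x)\<^sup>2) \<longleftrightarrow> integrable M (\<lambda>_. 0 :: real)"
      using sq by (intro integrable_cong_AE) auto
    moreover have "expectation (\<lambda>x. (Y x)\<^sup>2) = expectation (\<lambda>_. 0)"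
      using sq by (intro integral_cong_AE) auto
    moreover have "(\<integral>x. cis (Y x) \<partial>M) = (\<integral>x. 1 \<partial>M)"
      using 2 \<mu> by (intro integral_cong_AE) (auto simp: cis_conv_exp)
    ultimately show ?thesis by (simp add: prob_space)
  qed
  then show "integrable M (\<lambda>x. (Y x)\<^sup>2)" "(\<integral>x. cis (Y x) \<partial>M) = exp (- expectation (\<lambda>x. (Y x)\<^sup>2) / 2)"
    by auto
qed

section \<open>Covariances and characteristic functions of Gaussian processes\<close>

lemma gaussian_process_combination:
  "gaussian_process M V X \<Longrightarrow> finite F \<Longrightarrow> F \<subseteq> V \<Longrightarrow> gaussian_rv M (\<lambda>\<omega>. \<Sum>v\<in>F. c v * X v \<omega>)"
  by (simp add: gaussian_process_def jointly_gaussian_def)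

lemma
  assumes "gaussian_process M V X" and v: "v \<in> V"
  shows gaussian_process_measurable: "X v \<in> borel_measurable M"
    and gaussian_process_integrable_square: "integrable M (\<lambda>x. (X v x)\<^sup>2)"
    and gaussian_process_integrable: "integrable M (X v)"
    and gaussian_process_mean: "(\<integral>x. X v x \<partial>M) = 0"
proof -
  interpret prob_space M using assms by (simp add: gaussian_process_def)
  have G: "gaussian_rv M (X v)"
    using gaussian_process_combination [OF assms(1), of "{v}" "\<lambda>_. 1"] v by simp
  then show m: "X v \<in> borel_measurable M" by (simp add: gaussian_rv_def)
  show E: "(\<integral>x. X v x \<partial>M) = 0" using assms by (simp add: gaussian_process_def)
  show sq: "integrable M (\<lambda>x. (X v x)\<^sup>2)" by (rule centered_gaussian [OF G E])
  show "integrable M (X v)" by (rule square_integrable_imp_integrable [OF m sq])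
qed

lemma gaussian_process_integrable_mult:
  assumes X: "gaussian_process M V X" and uv: "u \<in> V" "v \<in> V"
  shows "integrable M (\<lambda>x. X u x * X v x)"
proof (rule Bochner_Integration.integrable_bound)
  show "integrable M (\<lambda>x. (X u x)\<^sup>2 + (X v x)\<^sup>2)"
    using gaussian_process_integrable_square [OF X] uv by auto
  have [measurable]: "X u \<in> borel_measurable M" "X v \<in> borel_measurable M"
    using gaussian_process_measurable [OF X] uv by auto
  show "(\<lambda>x. X u x * X v x) \<in> borel_measurable M" by measurable
  have "\<bar>a * b\<bar> \<le> a\<^sup>2 + b\<^sup>2" for a b :: real
  proof -
    have "2 * (\<bar>a\<bar> * \<bar>b\<bar>) \<le> a\<^sup>2 + b\<^sup>2"
      using sum_squares_bound [of "\<bar>a\<bar>" "\<bar>b\<bar>"] by simp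
    moreover have "0 \<le> \<bar>a\<bar> * \<bar>b\<bar>" by simp
    ultimately show ?thesis unfolding abs_mult by linarith
  qed
  then show "AE x in M. norm (X u x * X v x) \<le> norm ((X u x)\<^sup>2 + (X v x)\<^sup>2)"
    by simp
qed

lemma gaussian_process_char:
  assumes X: "gaussian_process M V X" and F: "finite F" "F \<subseteq> V"
  shows "(\<integral>x. cis (\<Sum>v\<in>F. t v * X v x) \<partial>M)
    = exp (- (\<Sum>u\<in>F. \<Sum>v\<in>F. t u * t v * (\<integral>x. X u x * X v x \<partial>M)) / 2)"
proof -
  interpret prob_space M using X by (simp add: gaussian_process_def)
  let ?Y = "\<lambda>x. \<Sum>v\<in>F. t v * X v x"
  have G: "gaussian_rv M ?Y" using X F by (rule gaussian_process_combination)
  have E: "expectation ?Y = 0"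
    using F gaussian_process_integrable [OF X] gaussian_process_mean [OF X]
    by (subst Bochner_Integration.integral_sum) (auto intro!: sum.neutral)
  have "expectation (\<lambda>x. (?Y x)\<^sup>2) = expectation (\<lambda>x. \<Sum>u\<in>F. \<Sum>v\<in>F. t u * t v * (X u x * X v x))"
    by (simp add: power2_eq_square sum_product ac_simps)
  also have "\<dots> = (\<Sum>u\<in>F. expectation (\<lambda>x. \<Sum>v\<in>F. t u * t v * (X u x * X v x)))"
    using F gaussian_process_integrable_mult [OF X]
    by (intro Bochner_Integration.integral_sum Bochner_Integration.integrable_sum integrable_mult_right) auto
  also have "\<dots> = (\<Sum>u\<in>F. \<Sum>v\<in>F. t u * t v * (\<integral>x. X u x * X v x \<partial>M))"
    using F gaussian_process_integrable_mult [OF X]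
    by (intro sum.cong refl, subst Bochner_Integration.integral_sum) (auto intro!: integrable_mult_right)
  finally show ?thesis using centered_gaussian(2) [OF G E] by simp
qed

text \<open>A law on the product space is determined by its cylinder sets even for infinite
  \<open>V\<close>, and each of these involves only finitely many coordinates, where
  \<open>cramer_wold\<close> applies.\<close>

theorem gaussian_joint_law_eqI:
  fixes X :: "'v \<Rightarrow> 'a \<Rightarrow> real" and X' :: "'v \<Rightarrow> 'b \<Rightarrow> real"
  assumes X: "gaussian_process M V X" and X': "gaussian_process M' V X'"
    and cov: "\<And>u v. u \<in> V \<Longrightarrow> v \<in> V \<Longrightarrow> (\<integral>x. X u x * X v x \<partial>M) = (\<integral>x. X' u x * X' v x \<partial>M')"
  shows "joint_law M V X = joint_law M' V X'"
proof (rule measure_eqI_PiM_infinite [where I = V and M = "\<lambda>_. borel"])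
  interpret M: prob_space M using X by (simp add: gaussian_process_def)
  interpret M': prob_space M' using X' by (simp add: gaussian_process_def)
  note m = gaussian_process_measurable [OF X] and m' = gaussian_process_measurable [OF X']
  have R: "(\<lambda>\<omega>. \<lambda>v\<in>V. X v \<omega>) \<in> measurable M (\<Pi>\<^sub>M v\<in>V. borel)"
    and R': "(\<lambda>\<omega>. \<lambda>v\<in>V. X' v \<omega>) \<in> measurable M' (\<Pi>\<^sub>M v\<in>V. borel)"
    using m m' by (auto intro!: measurable_restrict)
  show "sets (joint_law M V X) = sets (\<Pi>\<^sub>M v\<in>V. borel)" "sets (joint_law M' V X') = sets (\<Pi>\<^sub>M v\<in>V. borel)"
    by (simp_all add: joint_law_def)
  show "finite_measure (joint_law M V X)"
    unfolding joint_law_def by (rule M.finite_measure_distr [OF R])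
  fix A :: "'v \<Rightarrow> real set" and J assume J: "finite J" "J \<subseteq> V" and A: "\<And>i. i \<in> J \<Longrightarrow> A i \<in> sets borel"
  let ?P = "prod_emb V (\<lambda>_. borel) J (Pi\<^sub>E J A)"
  have P: "?P \<in> sets (\<Pi>\<^sub>M v\<in>V. borel)"
    using J A by (intro sets_PiM_I) auto
  have vimage: "(\<lambda>\<omega>. \<lambda>v\<in>V. Y v \<omega>) -` ?P \<inter> S = {\<omega> \<in> S. \<forall>j\<in>J. Y j \<omega> \<in> A j}"
    for Y :: "'v \<Rightarrow> 'z \<Rightarrow> real" and S
    using J(2) [THEN subsetD] by (auto simp: prod_emb_def PiE_iff)
  have "measure M {x \<in> space M. \<forall>j\<in>J. X j x \<in> A j} = measure M' {x \<in> space M'. \<forall>j\<in>J. X' j x \<in> A j}"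
  proof (rule cramer_wold [OF J(1) M.finite_measure_axioms M'.finite_measure_axioms])
    fix t :: "'v \<Rightarrow> real"
    have "(\<Sum>u\<in>J. \<Sum>v\<in>J. t u * t v * (\<integral>x. X u x * X v x \<partial>M))
        = (\<Sum>u\<in>J. \<Sum>v\<in>J. t u * t v * (\<integral>x. X' u x * X' v x \<partial>M'))"
      using cov J by (intro sum.cong refl) auto
    then show "(\<integral>x. cis (\<Sum>k\<in>J. t k * X k x) \<partial>M) = (\<integral>x. cis (\<Sum>k\<in>J. t k * X' k x) \<partial>M')"
      by (simp only: gaussian_process_char [OF X J] gaussian_process_char [OF X' J])
  qed (use J A m m' in auto)
  then show "emeasure (joint_law M V X) ?P = emeasure (joint_law M' V X') ?P"
    unfolding joint_law_def
    by (simp add: emeasure_distr [OF R P] emeasure_distr [OF R' P] vimage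
        M.emeasure_eq_measure M'.emeasure_eq_measure)
qed

section \<open>Linear combinations of independent normal variables\<close>

abbreviation iid_normal :: "'i set \<Rightarrow> ('i \<Rightarrow> real) measure" where
  "iid_normal I \<equiv> \<Pi>\<^sub>M i\<in>I. std_normal_distribution"

lemma prob_space_iid_normal: "prob_space (iid_normal I)"
  using real_dist_normal_dist by (intro prob_space_PiM) (simp add: real_distribution_def)

lemma distributed_iid_normal:
  assumes "i \<in> I"
  shows "distributed (iid_normal I) lborel (\<lambda>\<omega>. \<omega> i) std_normal_density"
proof -
  have "distr (iid_normal I) std_normal_distribution (\<lambda>\<omega>. \<omega> i) = std_normal_distribution"
    using real_dist_normal_dist assms by (intro distr_PiM_component) (auto simp: real_distribution_def)
  moreover have "distr (iid_normal I) lborel (\<lambda>\<omega>. \<omega> i) = distr (iid_normal I) std_normal_distribution (\<lambda>\<omega>. \<omega> i)"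
    by (rule distr_cong) auto
  moreover have "(\<lambda>\<omega>. \<omega> i) \<in> borel_measurable (iid_normal I)"
    using measurable_component_singleton [OF assms, of "\<lambda>_. std_normal_distribution"]
    by (simp cong: measurable_cong_sets)
  ultimately show ?thesis by (simp add: distributed_def)
qed

lemma indep_vars_iid_normal:
  assumes "I \<noteq> {}"
  shows "prob_space.indep_vars (iid_normal I) (\<lambda>_. borel) (\<lambda>i \<omega>. \<omega> i) I"
proof -
  interpret prob_space "iid_normal I" by (rule prob_space_iid_normal)
  have sets: "sets (\<Pi>\<^sub>M i\<in>I. borel) = sets (iid_normal I)"
    by (intro sets_PiM_cong) auto
  have m: "(\<lambda>\<omega>. \<omega> i) \<in> borel_measurable (iid_normal I)" if "i \<in> I" for i
    using distributed_iid_normal [OF that] by (simp add: distributed_def)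
  \<comment> \<open>Independence means that the joint law of the coordinates is the product of their
    laws. The law as a \<open>distr\<close> depends only on the sigma-algebra of its target, so the
    various Borel targets are interchangeable.\<close>
  have "distr (iid_normal I) (\<Pi>\<^sub>M i\<in>I. borel) (\<lambda>\<omega>. \<lambda>i\<in>I. \<omega> i) = distr (iid_normal I) (iid_normal I) (\<lambda>\<omega>. \<omega>)"
    using sets by (intro distr_cong) (auto simp: space_PiM)
  also have "\<dots> = iid_normal I" by (rule distr_id)
  also have "\<dots> = (\<Pi>\<^sub>M i\<in>I. distr (iid_normal I) borel (\<lambda>\<omega>. \<omega> i))"
  proof (rule PiM_cong)
    fix i assume "i \<in> I"
    then have "distr (iid_normal I) lborel (\<lambda>\<omega>. \<omega> i) = std_normal_distribution"
      by (rule distributed_distr_eq_density [OF distributed_iid_normal])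
    moreover have "distr (iid_normal I) borel (\<lambda>\<omega>. \<omega> i) = distr (iid_normal I) lborel (\<lambda>\<omega>. \<omega> i)"
      by (rule distr_cong) auto
    ultimately show "std_normal_distribution = distr (iid_normal I) borel (\<lambda>\<omega>. \<omega> i)" by simp
  qed simp
  finally show ?thesis
    using assms m by (subst indep_vars_iff_distr_eq_PiM') auto
qed

lemma
  assumes F: "finite F" "F \<subseteq> I"
  shows gaussian_rv_iid_combination: "gaussian_rv (iid_normal I) (\<lambda>\<omega>. \<Sum>i\<in>F. b i * \<omega> i)"
    and expectation_iid_combination: "(\<integral>\<omega>. (\<Sum>i\<in>F. b i * \<omega> i) \<partial>iid_normal I) = 0"
    and square_iid_combination: "(\<integral>\<omega>. (\<Sum>i\<in>F. b i * \<omega> i)\<^sup>2 \<partial>iid_normal I) = (\<Sum>i\<in>F. (b i)\<^sup>2)"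
proof -
  interpret prob_space "iid_normal I" by (rule prob_space_iid_normal)
  let ?Y = "\<lambda>\<omega>. \<Sum>i\<in>F. b i * \<omega> i"
  \<comment> \<open>Zero coefficients are dropped because a normal density needs a positive
    deviation; if none remain, the combination is the degenerate Gaussian 0.\<close>
  define G where "G = {i \<in> F. b i \<noteq> 0}"
  have G: "finite G" "G \<subseteq> I" using F by (auto simp: G_def)
  have Y: "(\<Sum>i\<in>F. b i * \<omega> i) = (\<Sum>i\<in>G. b i * \<omega> i)" for \<omega> :: "_ \<Rightarrow> real"
    using F unfolding G_def by (intro sum.mono_neutral_right) auto
  have b2: "(\<Sum>i\<in>F. (b i)\<^sup>2) = (\<Sum>i\<in>G. (b i)\<^sup>2)"
    using F unfolding G_def by (intro sum.mono_neutral_right) auto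
  have "gaussian_rv (iid_normal I) ?Y \<and> expectation ?Y = 0 \<and> expectation (\<lambda>\<omega>. (?Y \<omega>)\<^sup>2) = (\<Sum>i\<in>F. (b i)\<^sup>2)"
  proof (cases "G = {}")
    case True
    then show ?thesis unfolding Y b2 by (simp add: gaussian_rv_def)
  next
    case False
    let ?\<sigma> = "sqrt (\<Sum>i\<in>G. \<bar>b i\<bar>\<^sup>2)"
    have "indep_vars (\<lambda>_. borel) (\<lambda>i \<omega>. b i * \<omega> i) G"
      by (rule indep_vars_compose2 [OF indep_vars_subset [OF indep_vars_iid_normal]]) (use G False in auto)
    moreover have "distributed (iid_normal I) lborel (\<lambda>\<omega>. b i * \<omega> i) (normal_density 0 \<bar>b i\<bar>)" if "i \<in> G" for i
      using normal_density_affine [OF distributed_iid_normal [of i I], where \<alpha> = "b i" and \<beta> = 0] that G by (auto simp: G_def)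
    ultimately have "distributed (iid_normal I) lborel (\<lambda>\<omega>. \<Sum>i\<in>G. b i * \<omega> i) (normal_density (\<Sum>i\<in>G. 0) ?\<sigma>)"
      using G False by (intro sum_indep_normal) (auto simp: G_def)
    then have D: "distributed (iid_normal I) lborel ?Y (normal_density 0 ?\<sigma>)"
      unfolding Y by simp
    have \<sigma>: "0 < ?\<sigma>"
      using G False by (auto simp: G_def intro!: sum_pos)
    have E: "expectation ?Y = 0" by (rule normal_distributed_expectation [OF \<sigma> D])
    have "expectation (\<lambda>\<omega>. (?Y \<omega>)\<^sup>2) = ?\<sigma>\<^sup>2"
      using normal_distributed_variance [OF \<sigma> D] unfolding E by simp
    moreover have "gaussian_rv (iid_normal I) ?Y"
      using D \<sigma> distributed_measurable [OF D] unfolding gaussian_rv_def by auto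
    ultimately show ?thesis using E b2 by (simp add: sum_nonneg)
  qed
  then show "gaussian_rv (iid_normal I) ?Y" "expectation ?Y = 0"
    "expectation (\<lambda>\<omega>. (?Y \<omega>)\<^sup>2) = (\<Sum>i\<in>F. (b i)\<^sup>2)"
    by auto
qed

text \<open>Polarisation reduces the mixed moment to three second moments.\<close>

lemma covariance_iid_combination:
  assumes F: "finite F" "F \<subseteq> I"
  shows "(\<integral>\<omega>. (\<Sum>i\<in>F. a i * \<omega> i) * (\<Sum>i\<in>F. b i * \<omega> i) \<partial>iid_normal I) = (\<Sum>i\<in>F. a i * b i)"
proof -
  interpret prob_space "iid_normal I" by (rule prob_space_iid_normal)
  let ?Y = "\<lambda>c \<omega>. \<Sum>i\<in>F. c i * \<omega> i"
  have int: "integrable (iid_normal I) (\<lambda>\<omega>. (?Y c \<omega>)\<^sup>2)" for c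
    by (rule centered_gaussian(1) [OF gaussian_rv_iid_combination [OF F] expectation_iid_combination [OF F]])
  have "?Y a \<omega> * ?Y b \<omega> = ((?Y (\<lambda>i. a i + b i) \<omega>)\<^sup>2 - (?Y a \<omega>)\<^sup>2 - (?Y b \<omega>)\<^sup>2) / 2" for \<omega>
    by (simp add: ring_distribs sum.distrib power2_eq_square)
  then have "(\<integral>\<omega>. ?Y a \<omega> * ?Y b \<omega> \<partial>iid_normal I)
      = ((\<Sum>i\<in>F. (a i + b i)\<^sup>2) - (\<Sum>i\<in>F. (a i)\<^sup>2) - (\<Sum>i\<in>F. (b i)\<^sup>2)) / 2"
    by (simp only: Bochner_Integration.integral_diff int Bochner_Integration.integrable_diff
        integral_divide_zero square_iid_combination [OF F])
  also have "\<dots> = (\<Sum>i\<in>F. a i * b i)"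
    by (simp add: power2_sum sum.distrib sum_subtractf mult.assoc flip: sum_distrib_left)
  finally show ?thesis .
qed

section \<open>Gaussian eigenvector processes\<close>

lemma gaussian_process_reindex:
  fixes X :: "'v \<Rightarrow> 'a \<Rightarrow> real"
  assumes X: "gaussian_process M V X" and \<Phi>: "inj_on \<Phi> V" "\<Phi> ` V \<subseteq> V"
  shows "gaussian_process M V (\<lambda>v. X (\<Phi> v))"
  unfolding gaussian_process_def jointly_gaussian_def
proof (intro conjI allI impI ballI)
  show "prob_space M" using X by (simp add: gaussian_process_def)
  show "(\<integral>x. X (\<Phi> v) x \<partial>M) = 0" if "v \<in> V" for v
    using X \<Phi> that by (auto simp: gaussian_process_def)
  fix F :: "'v set" and c :: "'v \<Rightarrow> real" assume F: "finite F \<and> F \<subseteq> V"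
  then have inj: "inj_on \<Phi> F" using \<Phi> by (auto intro: inj_on_subset)
  then have "(\<Sum>v\<in>F. c v * X (\<Phi> v) \<omega>) = (\<Sum>w\<in>\<Phi> ` F. c (inv_into F \<Phi> w) * X w \<omega>)" for \<omega>
    by (simp add: sum.reindex)
  moreover have "gaussian_rv M (\<lambda>\<omega>. \<Sum>w\<in>\<Phi> ` F. c (inv_into F \<Phi> w) * X w \<omega>)"
    using F \<Phi> by (intro gaussian_process_combination [OF X]) auto
  ultimately show "gaussian_rv M (\<lambda>\<omega>. \<Sum>v\<in>F. c v * X (\<Phi> v) \<omega>)" by simp
qed

context tree_addresses
begin

section \<open>Existence: the process grown from the root\<close>

definition tree_ball :: "nat \<Rightarrow> 'v set" where
  "tree_ball N = {u \<in> V. length (\<psi> u) \<le> N}"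

definition tree_process :: "real \<Rightarrow> 'v \<Rightarrow> ('v \<Rightarrow> real) \<Rightarrow> real" where
  "tree_process l v \<omega> = (\<Sum>u\<in>tree_ball (length (\<psi> v)). coef d l (\<psi> v) (\<psi> u) * \<omega> u)"

lemma bij_tree_ball: "bij_betw \<psi> (tree_ball N) {z. address d z \<and> length z \<le> N}"
  by (rule bij_betw_byWitness [where f' = \<phi>]) (auto simp: tree_ball_def \<phi>_in_V)

lemma finite_tree_ball: "finite (tree_ball N)"
  using bij_betw_finite [OF bij_tree_ball] finite_addresses by simp

lemma tree_ball_subset: "tree_ball N \<subseteq> V"
  by (auto simp: tree_ball_def)

text \<open>Enlarging the ball adds only zero coefficients, so that several vertices can be expanded
  over one common finite index set.\<close>

lemma tree_process_eq:
  assumes "length (\<psi> v) \<le> N"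
  shows "tree_process l v \<omega> = (\<Sum>u\<in>tree_ball N. coef d l (\<psi> v) (\<psi> u) * \<omega> u)"
  unfolding tree_process_def
proof (rule sum.mono_neutral_left)
  show "tree_ball (length (\<psi> v)) \<subseteq> tree_ball N" using assms by (auto simp: tree_ball_def)
  show "\<forall>u\<in>tree_ball N - tree_ball (length (\<psi> v)). coef d l (\<psi> v) (\<psi> u) * \<omega> u = 0"
    by (auto simp: tree_ball_def intro!: coef_eq_0_if_longer)
qed (rule finite_tree_ball)

lemma covariance_tree_process:
  assumes d: "d \<ge> 3" "\<bar>l\<bar> \<le> real d" and uv: "u \<in> V" "v \<in> V"
  shows "(\<integral>\<omega>. tree_process l u \<omega> * tree_process l v \<omega> \<partial>iid_normal V)
    = tree_corr d l (tree_dist (\<psi> u) (\<psi> v))"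
proof -
  define N where "N = max (length (\<psi> u)) (length (\<psi> v))"
  have "(\<integral>\<omega>. tree_process l u \<omega> * tree_process l v \<omega> \<partial>iid_normal V)
      = (\<Sum>w\<in>tree_ball N. coef d l (\<psi> u) (\<psi> w) * coef d l (\<psi> v) (\<psi> w))"
    by (simp add: tree_process_eq [of _ N] N_def
        covariance_iid_combination [OF finite_tree_ball tree_ball_subset])
  also have "\<dots> = (\<Sum>z | address d z \<and> length z \<le> N. coef d l (\<psi> u) z * coef d l (\<psi> v) z)"
    by (rule sum.reindex_bij_betw [OF bij_tree_ball])
  also have "\<dots> = tree_corr d l (tree_dist (\<psi> u) (\<psi> v))"
    using uv by (intro sum_coef_coef d) (auto simp: N_def)
  finally show ?thesis .
qed

lemma gaussian_tree_process: "gaussian_process (iid_normal V) V (tree_process l)"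
  unfolding gaussian_process_def jointly_gaussian_def
proof (intro conjI allI impI ballI)
  show "prob_space (iid_normal V)" by (rule prob_space_iid_normal)
  show "(\<integral>\<omega>. tree_process l v \<omega> \<partial>iid_normal V) = 0" for v
    unfolding tree_process_def by (rule expectation_iid_combination [OF finite_tree_ball tree_ball_subset])
  fix F :: "'v set" and c assume F: "finite F \<and> F \<subseteq> V"
  \<comment> \<open>The inserted 0 keeps the maximum meaningful for empty \<open>F\<close>.\<close>
  define N where "N = Max (insert 0 ((\<lambda>v. length (\<psi> v)) ` F))"
  have "length (\<psi> v) \<le> N" if "v \<in> F" for v
    unfolding N_def using F that by (intro Max_ge) auto
  then have "(\<Sum>v\<in>F. c v * tree_process l v \<omega>)
      = (\<Sum>v\<in>F. c v * (\<Sum>u\<in>tree_ball N. coef d l (\<psi> v) (\<psi> u) * \<omega> u))" for \<omega>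
    by (intro sum.cong refl) (simp add: tree_process_eq)
  also have "\<dots> \<omega> = (\<Sum>u\<in>tree_ball N. (\<Sum>v\<in>F. c v * coef d l (\<psi> v) (\<psi> u)) * \<omega> u)" for \<omega>
    by (simp add: sum_distrib_left sum_distrib_right mult.assoc) (rule sum.swap)
  finally show "gaussian_rv (iid_normal V) (\<lambda>\<omega>. \<Sum>v\<in>F. c v * tree_process l v \<omega>)"
    using gaussian_rv_iid_combination [OF finite_tree_ball tree_ball_subset] by simp
qed

lemma sum_nbrs_tree_process:
  assumes d: "d \<ge> 3" and v: "v \<in> V"
  shows "(\<Sum>u\<in>nbrs E v. tree_process l u \<omega>) = l * tree_process l v \<omega>"
proof -
  define x where "x = \<psi> v"
  \<comment> \<open>The children of \<open>x\<close>, one level deeper, must fit into the common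
    ball.\<close>
  define N where "N = Suc (length x)"
  have x: "address d x" "\<phi> x = v" using v by (simp_all add: x_def)
  have P: "tree_process l (\<phi> y) \<omega> = (\<Sum>w\<in>tree_ball N. coef d l y (\<psi> w) * \<omega> w)"
    if "address d y" "length y \<le> N" for y
    using that by (simp add: tree_process_eq)
  have "(\<Sum>u\<in>nbrs E v. tree_process l u \<omega>) = (\<Sum>i<num_children d x. tree_process l (\<phi> (i # x)) \<omega>)
      + (if x = [] then 0 else tree_process l (\<phi> (tl x)) \<omega>)"
    unfolding x(2) [symmetric] by (rule sum_nbrs_\<phi> [OF x(1)])
  also have "(\<Sum>i<num_children d x. tree_process l (\<phi> (i # x)) \<omega>)
      = (\<Sum>w\<in>tree_ball N. (\<Sum>i<num_children d x. coef d l (i # x) (\<psi> w)) * \<omega> w)"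
    using x by (simp add: P N_def sum_distrib_right) (rule sum.swap)
  also have "(if x = [] then 0 else tree_process l (\<phi> (tl x)) \<omega>)
      = (\<Sum>w\<in>tree_ball N. (if x = [] then 0 else coef d l (tl x) (\<psi> w)) * \<omega> w)"
    using x by (cases x) (auto simp: P N_def)
  also have "(\<Sum>w\<in>tree_ball N. (\<Sum>i<num_children d x. coef d l (i # x) (\<psi> w)) * \<omega> w)
      + (\<Sum>w\<in>tree_ball N. (if x = [] then 0 else coef d l (tl x) (\<psi> w)) * \<omega> w)
      = (\<Sum>w\<in>tree_ball N. l * coef d l x (\<psi> w) * \<omega> w)"
    unfolding sum.distrib [symmetric] distrib_right [symmetric]
    by (intro sum.cong refl arg_cong2 [where f = "(*)"] sum_coef_children d) (auto simp: tree_ball_def)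
  also have "\<dots> = l * tree_process l v \<omega>"
    using P [of x] x by (simp add: N_def sum_distrib_left mult.assoc)
  finally show ?thesis .
qed

lemma eigenprocess_tree_process:
  assumes d: "d \<ge> 3" "\<bar>l\<bar> \<le> real d"
  shows "gaussian_eigenprocess (iid_normal V) V E l (tree_process l)"
  unfolding gaussian_eigenprocess_def
proof (intro conjI)
  interpret prob_space "iid_normal V" by (rule prob_space_iid_normal)
  show G: "gaussian_process (iid_normal V) V (tree_process l)" by (rule gaussian_tree_process)
  show "invariant_process (iid_normal V) V E (tree_process l)"
    unfolding invariant_process_def
  proof
    fix \<Phi> assume \<Phi>: "\<Phi> \<in> graph_aut V E"
    then have "inj_on \<Phi> V" "\<Phi> ` V = V" by (auto simp: graph_aut_def bij_betw_def)
    then have \<Phi>V: "\<Phi> v \<in> V" if "v \<in> V" for v using that by blast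
    have "gaussian_process (iid_normal V) V (\<lambda>v. tree_process l (\<Phi> v))"
      using \<open>inj_on \<Phi> V\<close> \<open>\<Phi> ` V = V\<close> by (intro gaussian_process_reindex [OF G]) auto
    then show "joint_law (iid_normal V) V (\<lambda>v. tree_process l (\<Phi> v)) = joint_law (iid_normal V) V (tree_process l)"
      by (rule gaussian_joint_law_eqI [OF _ G])
        (simp add: covariance_tree_process [OF d] tree_dist_automorphism [OF \<Phi>] \<Phi>V)
  qed
  show "nontrivial_process (iid_normal V) V (tree_process l)"
    unfolding nontrivial_process_def
  proof (intro ballI notI)
    fix v assume v: "v \<in> V" and "AE \<omega> in iid_normal V. tree_process l v \<omega> = 0"
    then have "expectation (\<lambda>\<omega>. tree_process l v \<omega> * tree_process l v \<omega>) = expectation (\<lambda>_. 0)"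
      by (intro integral_cong_AE) (use gaussian_process_measurable [OF G v] in auto)
    then show False using covariance_tree_process [OF d v v] by simp
  qed
  show "eigenvector_equation (iid_normal V) V E l (tree_process l)"
    by (simp add: eigenvector_equation_def sum_nbrs_tree_process [OF d(1)])
qed

lemma eigenprocess_covariance:
  assumes d: "d \<ge> 3" and X: "gaussian_eigenprocess M V E l X"
    and var: "\<And>v. v \<in> V \<Longrightarrow> (\<integral>\<omega>. (X v \<omega>)\<^sup>2 \<partial>M) = 1" and x: "address d x"
  shows "(\<integral>\<omega>. X (\<phi> []) \<omega> * X (\<phi> x) \<omega> \<partial>M) = tree_corr d l (length x)"
proof -
  define r where "r = \<phi> []"
  define C where "C u = (\<integral>\<omega>. X r \<omega> * X u \<omega> \<partial>M)" for u
  have G: "gaussian_process M V X" and inv: "invariant_process M V E X"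
    and eigen: "AE \<omega> in M. \<forall>v\<in>V. (\<Sum>u\<in>nbrs E v. X u \<omega>) = l * X v \<omega>"
    using X by (auto simp: gaussian_eigenprocess_def eigenvector_equation_def)
  note m = gaussian_process_measurable [OF G] and int = gaussian_process_integrable_mult [OF G]
  have r: "r \<in> V" unfolding r_def by (rule \<phi>_in_V) simp
  \<comment> \<open>Invariance speaks about joint laws, so second moments are expressed through
    \<open>joint_law\<close> before an automorphism is applied.\<close>
  have law: "(\<integral>\<omega>. Y u \<omega> * Y v \<omega> \<partial>M) = (\<integral>f. f u * f v \<partial>joint_law M V Y)"
    if Y: "\<And>v. v \<in> V \<Longrightarrow> Y v \<in> borel_measurable M" and uv: "u \<in> V" "v \<in> V" for Y :: "'v \<Rightarrow> _ \<Rightarrow> real" and u v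
    unfolding joint_law_def using uv
    by (subst integral_distr) (auto intro!: measurable_restrict Y borel_measurable_times)
  have C_aut: "C (\<Phi> u) = C u" if \<Phi>: "\<Phi> \<in> graph_aut V E" "\<Phi> r = r" and u: "u \<in> V" for \<Phi> u
  proof -
    have \<Phi>V: "\<Phi> v \<in> V" if "v \<in> V" for v
      using \<Phi> that by (auto simp: graph_aut_def bij_betw_def)
    have "C (\<Phi> u) = (\<integral>f. f r * f u \<partial>joint_law M V (\<lambda>v. X (\<Phi> v)))"
      using law [of "\<lambda>v. X (\<Phi> v)" r u] m \<Phi>V r u \<Phi>(2) by (simp add: C_def)
    also have "joint_law M V (\<lambda>v. X (\<Phi> v)) = joint_law M V X"
      using inv \<Phi>(1) by (simp add: invariant_process_def)
    also have "(\<integral>f. f r * f u \<partial>joint_law M V X) = C u"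
      using law [of X r u] m r u by (simp add: C_def)
    finally show ?thesis .
  qed
  have C_sib: "C (\<phi> (i # v)) = C (\<phi> (0 # v))" if v: "address d v" "i < num_children d v" for i v
  proof -
    have "0 < num_children d v" using v by simp
    then obtain \<Phi> where "\<Phi> \<in> graph_aut V E" "\<Phi> (\<phi> []) = \<phi> []" "\<Phi> (\<phi> (0 # v)) = \<phi> (i # v)"
      using sibling_automorphism [of 0 v i] v by blast
    then show ?thesis using C_aut [of \<Phi> "\<phi> (0 # v)"] v by (simp add: r_def \<phi>_in_V)
  qed
  \<comment> \<open>The eigenvector equation at \<open>\<phi> v\<close> is multiplied by
    \<open>X r\<close> and integrated. By \<open>C_sib\<close> all children contribute equally and
    are represented by child 0.\<close>
  have C_eigen: "num_children d v * C (\<phi> (0 # v)) + (if v = [] then 0 else C (\<phi> (tl v))) = l * C (\<phi> v)"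
    if v: "address d v" for v
  proof -
    have vV: "\<phi> v \<in> V" by (rule \<phi>_in_V [OF v])
    have nV: "u \<in> V" if "u \<in> nbrs E (\<phi> v)" for u using that EV by (auto simp: nbrs_def)
    have "l * C (\<phi> v) = (\<integral>\<omega>. X r \<omega> * (l * X (\<phi> v) \<omega>) \<partial>M)"
      by (simp add: C_def mult.left_commute)
    also have "\<dots> = (\<integral>\<omega>. X r \<omega> * (\<Sum>u\<in>nbrs E (\<phi> v). X u \<omega>) \<partial>M)"
    proof (rule integral_cong_AE)
      show "AE \<omega> in M. X r \<omega> * (l * X (\<phi> v) \<omega>) = X r \<omega> * (\<Sum>u\<in>nbrs E (\<phi> v). X u \<omega>)"
        using eigen by eventually_elim (use vV in simp)
    qed (use m r vV nV in \<open>auto intro!: borel_measurable_times borel_measurable_sum\<close>)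
    also have "\<dots> = (\<Sum>u\<in>nbrs E (\<phi> v). C u)"
      unfolding sum_distrib_left C_def using int r nV by (intro Bochner_Integration.integral_sum) auto
    also have "\<dots> = (\<Sum>i<num_children d v. C (\<phi> (i # v))) + (if v = [] then 0 else C (\<phi> (tl v)))"
      by (rule sum_nbrs_\<phi> [OF v])
    also have "(\<Sum>i<num_children d v. C (\<phi> (i # v))) = (\<Sum>i<num_children d v. C (\<phi> (0 # v)))"
      by (intro sum.cong refl C_sib [OF v]) simp
    finally show ?thesis by simp
  qed
  have "C (\<phi> x) = tree_corr d l (length x)"
    using x
  \<comment> \<open>Strong induction, since the recursion reaches back to the grandparent.\<close>
  proof (induction x rule: length_induct)
    case (1 x)
    show ?case
    proof (cases x)
      case Nil
      then show ?thesis using var [OF r] by (simp add: C_def r_def power2_eq_square)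
    next
      case (Cons i v)
      then have v: "address d v" "i < num_children d v" using 1 by auto
      have "C (\<phi> x) = C (\<phi> (0 # v))" using C_sib [OF v] Cons by simp
      moreover have "C (\<phi> v) = tree_corr d l (length v)" using 1 Cons v by simp
      ultimately show ?thesis
        using C_eigen [OF v(1)] d Cons 1
        by (cases v) (auto simp: num_children_def field_simps of_nat_diff)
    qed
  qed
  then show ?thesis by (simp add: C_def r_def)
qed

end

theorem theorem3:
  fixes d :: nat and V :: "'v set" and E :: "('v \<times> 'v) set" and l :: real
  assumes "d \<ge> 3" and "regular_infinite_tree d V E" and "\<bar>l\<bar> \<le> real d"
  shows "(\<exists>(M :: ('v \<Rightarrow> real) measure) X. gaussian_eigenprocess M V E l X) \<and>
    (\<forall>(M :: 'a measure) X (M' :: 'b measure) X'.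
       gaussian_eigenprocess M V E l X \<and> (\<forall>v\<in>V. prob_space.variance M (X v) = 1) \<and>
       gaussian_eigenprocess M' V E l X' \<and> (\<forall>v\<in>V. prob_space.variance M' (X' v) = 1) \<longrightarrow>
       joint_law M V X = joint_law M' V X')"
proof (intro conjI allI impI)
  have EV: "E \<subseteq> V \<times> V" and ne: "V \<noteq> {}"
    using assms(2) by (auto simp: regular_infinite_tree_def tree_graph_def simple_graph_def)
  have addresses: "\<exists>\<phi>. tree_addresses d V E \<phi> \<and> \<phi> [] = r" if r: "r \<in> V" for r
  proof (rule regular_tree_addresses [OF assms(2) r])
    fix \<phi> assume \<phi>: "bij_betw \<phi> {x. address d x} V" "\<phi> [] = r"
      "\<And>x y. address d x \<Longrightarrow> address d y \<Longrightarrow>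
        (\<phi> x, \<phi> y) \<in> E \<longleftrightarrow> (\<exists>i. x = i # y) \<or> (\<exists>i. y = i # x)"
    have "tree_addresses d V E \<phi>"
      using EV \<phi>(1,3) by (rule tree_addresses.intro)
    with \<phi>(2) show ?thesis by blast
  qed
  obtain r where "r \<in> V" using ne by blast
  then obtain \<phi> where "tree_addresses d V E \<phi>" using addresses by blast
  then show "\<exists>(M :: ('v \<Rightarrow> real) measure) X. gaussian_eigenprocess M V E l X"
    using tree_addresses.eigenprocess_tree_process assms(1,3) by blast
  fix M :: "'a measure" and X and M' :: "'b measure" and X'
  assume *: "gaussian_eigenprocess M V E l X \<and> (\<forall>v\<in>V. prob_space.variance M (X v) = 1) \<and>
    gaussian_eigenprocess M' V E l X' \<and> (\<forall>v\<in>V. prob_space.variance M' (X' v) = 1)"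
  have G: "gaussian_process M V X" and G': "gaussian_process M' V X'"
    using * by (simp_all add: gaussian_eigenprocess_def)
  have var: "(\<integral>\<omega>. (X v \<omega>)\<^sup>2 \<partial>M) = 1" "(\<integral>\<omega>. (X' v \<omega>)\<^sup>2 \<partial>M') = 1" if "v \<in> V" for v
    using * that gaussian_process_mean [OF G that] gaussian_process_mean [OF G' that] by auto
  show "joint_law M V X = joint_law M' V X'"
  proof (rule gaussian_joint_law_eqI [OF G G'])
    fix u v assume uv: "u \<in> V" "v \<in> V"
    \<comment> \<open>Taking \<open>u\<close> itself as root turns an arbitrary covariance into one
      with the root, which \<open>eigenprocess_covariance\<close> computes for both
      processes.\<close>
    obtain \<phi> where "tree_addresses d V E \<phi>" and u: "\<phi> [] = u" using addresses uv by blast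
    then interpret tree_addresses d V E \<phi> by simp
    have "\<phi> (\<psi> v) = v" "address d (\<psi> v)" using uv by simp_all
    then show "(\<integral>x. X u x * X v x \<partial>M) = (\<integral>x. X' u x * X' v x \<partial>M')"
      using eigenprocess_covariance [of M l X "\<psi> v"] eigenprocess_covariance [of M' l X' "\<psi> v"]
        assms(1) * var u by simp
  qed
qed

end
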